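(* Let $n\ge 2$ be an integer, let $a:\{1,\ldots,n\}\to\mathbb{R}$ satisfy $a_i<a_{i+1}$ for all $1\le i<n$, and let $E\in\mathbb{R}$ with $a_1<E<a_n$. Define $f,I_f:\mathbb{R}\to\mathbb{R}$ by \[f(t)=\frac{\sum_{i=1}^n a_i e^{t a_i}}{\sum_{i=1}^n e^{t a_i}}-E,\qquad I_f(t)=t-\frac{f(t)}{(a_n-a_1)^2}.\] For a non-pure state $x\in\Delta^n$ define \[\ell(x)=\begin{cases}\dfrac{\log\left(\mathrm{sort}(x)_1/\mathrm{sort}(x)_2\right)}{a_n-a_{n-1}} & \text{if } I_f(0)>0,\\[2ex] \dfrac{\log\left(\mathrm{sort}(x)_1/\mathrm{sort}(x)_2\right)}{a_1-a_2} & \text{otherwise,}\end{cases}\] and for a pure state $x$ set $\ell(x)=+\infty$ if $I_f(0)>0$ and $\ell(x)=-\infty$ otherwise. Define $\phi:\Delta^n\to\Delta^n$ by \[\phi(x)=\frac{1}{Z(x)}\left(e^{I_f(\ell(x))a_1},\ldots,e^{I_f(\ell(x))a_n}\right),\qquad Z(x)=\sum_{i=1}^n e^{I_f(\ell(x))a_i},\] where for pure $x$ the value is understood as the limit of the corresponding expression as $\ell(x)\to\pm\infty$, i.e. $\phi(x)=e_n$ if $I_f(0)>0$ and $\phi(x)=e_1$ otherwise. Then $\phi$ is Scott continuous with respect to the Bayesian order $\sqsubseteq$ on $\Delta^n$, and its least fixed point is the maximum entropy state, i.e. the unique state $y\in\Delta^n$ with $\langle a|y\rangle=E$ and $\sigma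 y=\sup\{\sigma x: x\in\Delta^n,\ \langle a|x\rangle=E\}$.
   Context: Classical states: $\Delta^n=\{x\in[0,1]^n:\sum_{i=1}^n x_i=1\}$ for $n\ge 2$. A state $x$ is pure when $x_i=1$ for some $i$; this state is denoted $e_i$. For $a:\{1,\ldots,n\}\to\mathbb{R}$ and $x\in\Delta^n$, $\langle a|x\rangle=\sum_{i=1}^n a_ix_i$. Shannon entropy is $\sigma x=-\sum_{i=1}^n x_i\log x_i$ (natural logarithm, $0\log 0=0$). The vector $\mathrm{sort}(x)$ is $x$ with its entries rearranged into decreasing order. Bayesian order: for $x\in\Delta^{m+1}$ with $x\ne e_i$ let $p_i(x)=\frac{1}{1-x_i}(x_1,\ldots,\widehat{x_i},\ldots,x_{m+1})\in\Delta^m$ ($x_i$ removed, then renormalized), so $\mathrm{dom}(p_i)=\Delta^{m+1}\setminus\{e_i\}$. The relation $\sqsubseteq$ is defined inductively. For $x,y\in\Delta^2$: $x\sqsubseteq y$ iff ($y_1\le x_1\le 1/2$) or ($1/2\le x_1\le y_1$). For $x,y\in\Delta^{m+1}$, $m\ge 2$: $x\sqsubseteq y$ iff for all $i$, if $x,y\in\mathrm{dom}(p_i)$ then $p_i(x)\sqsubseteq p_i(y)$. It is known that this is a partial order making $\Delta^n$ a dcpo with least element $\bot=(1/n,\ldots,1/n)$, and that, equivalently, $x\sqsubseteq y$ iff there is a permutation $\pi$ of $\{1,\ldots,n\}$ such that $x\cdot\pi$ and $y\cdot\pi$ (the states with entries permuted by $\pi$) both have decreasing entries and $(x\cdot\pi)_i(y\cdot\pi)_{i+1}\le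 (x\cdot\pi)_{i+1}(y\cdot\pi)_i$ for all $1\le i<n$. A nonempty subset $S$ of a poset is directed if any two elements of $S$ have an upper bound in $S$. A dcpo is a poset in which every directed subset has a supremum. A map $g:D\to D'$ between dcpo's is Scott continuous if it is monotone and $g(\bigsqcup S)=\bigsqcup g(S)$ for every directed $S\subseteq D$. *)

theory Defs
  imports
    Complex_Main
    "HOL-Library.Extended_Real"
    "HOL-Algebra.Complete_Lattice"
begin

section \<open>Directed complete partial orders and Scott continuity\<close>

definition directed :: "('a, 'b) gorder_scheme \<Rightarrow> 'a set \<Rightarrow> bool" where
  "directed L S \<longleftrightarrow>
     S \<subseteq> carrier L \<and> S \<noteq> {} \<and> (\<forall>x\<in>S. \<forall>y\<in>S. \<exists>z\<in>S. x \<sqsubseteq>\<^bsub>L\<^esub> z \<and> y \<sqsubseteq>\<^bsub>L\<^esub> z)"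

locale dcpo = partial_order +
  assumes directed_sup_exists: "directed L S \<Longrightarrow> \<exists>s. is_lub L s S"

definition scott_continuous ::
    "('a, 'c) gorder_scheme \<Rightarrow> ('b, 'd) gorder_scheme \<Rightarrow> ('a \<Rightarrow> 'b) \<Rightarrow> bool" where
  "scott_continuous L M g \<longleftrightarrow>
     dcpo L \<and> dcpo M \<and> g \<in> carrier L \<rightarrow> carrier M \<and> isotone L M g \<and>
     (\<forall>S. directed L S \<longrightarrow> g (\<Squnion>\<^bsub>L\<^esub>S) = \<Squnion>\<^bsub>M\<^esub>(g ` S))"

section \<open>Classical states and the Bayesian order\<close>

text \<open>
  The Bayesian order is defined by recursion on the dimension, so vectors of length \<open>n\<close> are
  functions \<open>nat \<Rightarrow> real\<close> with entries indexed by \<open>{1..n}\<close>, extended by 0. This makes equality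
  of functions coincide with equality of vectors on \<open>states n\<close>.
\<close>

definition states :: "nat \<Rightarrow> (nat \<Rightarrow> real) set" where
  "states n = {x. (\<forall>i\<in>{1..n}. 0 \<le> x i \<and> x i \<le> 1) \<and> (\<forall>i. i \<notin> {1..n} \<longrightarrow> x i = 0) \<and>
                  (\<Sum>i=1..n. x i) = 1}"

definition pure_state :: "nat \<Rightarrow> nat \<Rightarrow> real" where
  "pure_state i = (\<lambda>j. if j = i then 1 else 0)"

definition is_pure :: "nat \<Rightarrow> (nat \<Rightarrow> real) \<Rightarrow> bool" where
  "is_pure n x \<longleftrightarrow> (\<exists>i\<in>{1..n}. x i = 1)"

text \<open>Entry \<open>i\<close> is deleted, so the later entries move down by one index.\<close>

definition bayes_proj :: "nat \<Rightarrow> (nat \<Rightarrow> real) \<Rightarrow> nat \<Rightarrow> real" where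
  "bayes_proj i x = (\<lambda>j. (if j < i then x j else x (Suc j)) / (1 - x i))"

definition bayes_dom :: "nat \<Rightarrow> nat \<Rightarrow> (nat \<Rightarrow> real) set" where
  "bayes_dom n i = states n - {pure_state i}"

text \<open>The relation is only of interest for \<open>n \<ge> 2\<close>; the first two equations are junk values.\<close>

fun bayes_le :: "nat \<Rightarrow> (nat \<Rightarrow> real) \<Rightarrow> (nat \<Rightarrow> real) \<Rightarrow> bool" where
  "bayes_le 0 x y \<longleftrightarrow> False"
| "bayes_le (Suc 0) x y \<longleftrightarrow> False"
| "bayes_le (Suc (Suc 0)) x y \<longleftrightarrow> (y 1 \<le> x 1 \<and> x 1 \<le> 1/2) \<or> (1/2 \<le> x 1 \<and> x 1 \<le> y 1)"
| "bayes_le (Suc (Suc (Suc m))) x y \<longleftrightarrow>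
     (\<forall>i\<in>{1..Suc (Suc (Suc m))}.
        x \<in> bayes_dom (Suc (Suc (Suc m))) i \<and> y \<in> bayes_dom (Suc (Suc (Suc m))) i \<longrightarrow>
        bayes_le (Suc (Suc m)) (bayes_proj i x) (bayes_proj i y))"

definition bayes_order :: "nat \<Rightarrow> (nat \<Rightarrow> real) gorder" where
  "bayes_order n = \<lparr>carrier = states n, eq = (=), le = bayes_le n\<rparr>"

section \<open>Entropy, expectation, maximum entropy states\<close>

definition expect :: "nat \<Rightarrow> (nat \<Rightarrow> real) \<Rightarrow> (nat \<Rightarrow> real) \<Rightarrow> real" where
  "expect n a x = (\<Sum>i=1..n. a i * x i)"

text \<open>In HOL the product \<open>0 * ln 0\<close> is 0, which is the usual convention for entropy.\<close>

definition entropy :: "nat \<Rightarrow> (nat \<Rightarrow> real) \<Rightarrow> real" where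
  "entropy n x = - (\<Sum>i=1..n. x i * ln (x i))"

definition max_entropy_state :: "nat \<Rightarrow> (nat \<Rightarrow> real) \<Rightarrow> real \<Rightarrow> (nat \<Rightarrow> real) \<Rightarrow> bool" where
  "max_entropy_state n a E y \<longleftrightarrow>
     y \<in> states n \<and> expect n a y = E \<and>
     entropy n y = (SUP x\<in>{x \<in> states n. expect n a x = E}. entropy n x)"

section \<open>The map whose least fixed point is the maximum entropy state\<close>

definition mean_gap :: "nat \<Rightarrow> (nat \<Rightarrow> real) \<Rightarrow> real \<Rightarrow> real \<Rightarrow> real" where
  "mean_gap n a E t =
     (\<Sum>i=1..n. a i * exp (t * a i)) / (\<Sum>i=1..n. exp (t * a i)) - E"

definition I_f :: "nat \<Rightarrow> (nat \<Rightarrow> real) \<Rightarrow> real \<Rightarrow> real \<Rightarrow> real" where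
  "I_f n a E t = t - mean_gap n a E t / (a n - a 1)\<^sup>2"

text \<open>The list function \<open>sort\<close> sorts increasingly; entries of \<open>sort_desc\<close> are indexed from 1.\<close>

definition sort_desc :: "nat \<Rightarrow> (nat \<Rightarrow> real) \<Rightarrow> nat \<Rightarrow> real" where
  "sort_desc n x i = rev (sort (map x [1..<Suc n])) ! (i - 1)"

definition ell :: "nat \<Rightarrow> (nat \<Rightarrow> real) \<Rightarrow> real \<Rightarrow> (nat \<Rightarrow> real) \<Rightarrow> ereal" where
  "ell n a E x =
     (if is_pure n x then (if I_f n a E 0 > 0 then \<infinity> else -\<infinity>)
      else if I_f n a E 0 > 0
        then ereal (ln (sort_desc n x 1 / sort_desc n x 2) / (a n - a (n - 1)))
        else ereal (ln (sort_desc n x 1 / sort_desc n x 2) / (a 1 - a 2)))"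

definition gibbs :: "nat \<Rightarrow> (nat \<Rightarrow> real) \<Rightarrow> real \<Rightarrow> nat \<Rightarrow> real" where
  "gibbs n a t =
     (\<lambda>i. if i \<in> {1..n} then exp (t * a i) / (\<Sum>j=1..n. exp (t * a j)) else 0)"

text \<open>
  For \<open>a\<close> strictly increasing on \<open>{1..n}\<close>, the last two cases are the limits of
  \<open>gibbs n a (I_f n a E t)\<close> as \<open>t\<close> tends to \<open>\<infinity>\<close> and \<open>-\<infinity>\<close>.
\<close>

definition phi :: "nat \<Rightarrow> (nat \<Rightarrow> real) \<Rightarrow> real \<Rightarrow> (nat \<Rightarrow> real) \<Rightarrow> nat \<Rightarrow> real" where
  "phi n a E x =
     (case ell n a E x of
        ereal t \<Rightarrow> gibbs n a (I_f n a E t)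
      | PInfty \<Rightarrow> pure_state n
      | MInfty \<Rightarrow> pure_state 1)"

end

theory Submission
  imports Defs "HOL-Library.Multiset"
begin

text \<open>
  The recursive definition of the Bayesian order unfolds to a condition on pairs of indices: \<open>x\<close> is below
  \<open>y\<close> iff each pair of entries is ordered the same way in both states and the ratio of the larger to the
  smaller one does not decrease (\<open>bayes_le_iff_pairwise\<close>). This condition is closed under pointwise
  limits, and it makes the order axioms elementary. A directed set \<open>S\<close> has a common
  index \<open>k\<close> of a maximal entry, and the ratios \<open>x j / x k\<close> decrease along the order; normalizing their
  infima gives the supremum, which is a pointwise limit of a sequence in \<open>S\<close> (\<open>directed_limit\<close>).

  The map \<open>phi\<close> depends on a state only through the ratio \<open>q\<close> of its second largest to its largest
  entry. This ratio is antitone, and continuous along the sequences just mentioned. From \<open>q\<close> one passes to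
  the parameter \<open>- ln q / slope\<close>, then applies \<open>I_f\<close>, which is monotone because the derivative of the
  mean energy is a variance, bounded by \<open>(a n - a 1)\<^sup>2\<close>; finally one forms a Gibbs state, and Gibbs
  states increase as their parameter moves away from 0. The case distinction on \<open>I_f n a E 0\<close> keeps all
  parameters on one side of 0. So \<open>phi\<close> is monotone, and by the continuity of all ingredients,
  including the limit \<open>q = 0\<close>, where Gibbs states tend to a pure state, it is Scott continuous.

  By the Gibbs inequality (\<open>entropy_le_gibbs\<close>) a Gibbs state is the unique entropy maximizer among
  the states with the same expectation, so the maximum entropy state is the Gibbs state of a zero \<open>t\<close> of
  \<open>mean_gap\<close>, which exists by the intermediate value theorem. On Gibbs states \<open>phi\<close> acts on parameters
  as \<open>I_f\<close>, a Newton-like iteration whose fixed points are the zeros of \<open>mean_gap\<close>. Hence the only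
  fixed points are the maximum entropy state and possibly a pure state above it.
\<close>

section \<open>States\<close>

lemma states_nonneg: "x \<in> states n \<Longrightarrow> 0 \<le> x i"
  by (cases "i \<in> {1..n}") (auto simp: states_def)

lemma states_sum: "x \<in> states n \<Longrightarrow> (\<Sum>i=1..n. x i) = 1"
  by (simp add: states_def)

lemma statesI:
  assumes "\<And>i. 0 \<le> x i" "\<And>i. i \<notin> {1..n} \<Longrightarrow> x i = 0" "(\<Sum>i=1..n. x i) = 1"
  shows "x \<in> states n"
proof -
  have "x i \<le> 1" if "i \<in> {1..n}" for i
    using member_le_sum[of i "{1..n}" x] assms that by auto
  then show ?thesis using assms by (auto simp: states_def)
qed

lemma states_pos_entry:
  assumes "x \<in> states n"
  obtains k where "k \<in> {1..n}" "0 < x k"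
proof -
  have "\<exists>k\<in>{1..n}. 0 < x k"
  proof (rule ccontr)
    assume "\<not> ?thesis"
    then have "(\<Sum>i=1..n. x i) \<le> 0" by (intro sum_nonpos) (simp add: not_less)
    then show False using states_sum[OF assms] by simp
  qed
  then show ?thesis using that by blast
qed

lemma states_eq_pure:
  assumes "x \<in> states n" "i \<in> {1..n}" "x i = 1"
  shows "x = pure_state i"
proof
  fix j
  have "(\<Sum>k\<in>{1..n}-{i}. x k) = 0"
    using sum.remove[of "{1..n}" i x] assms states_sum[OF assms(1)] by simp
  then have "\<forall>k\<in>{1..n}-{i}. x k = 0"
    using states_nonneg[OF assms(1)] by (subst (asm) sum_nonneg_eq_0_iff) auto
  then show "x j = pure_state i j"
    using assms by (cases "j \<in> {1..n}") (auto simp: pure_state_def states_def)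
qed

lemma pure_state_in_states: "i \<in> {1..n} \<Longrightarrow> pure_state i \<in> states n"
  by (rule statesI) (auto simp: pure_state_def)

section \<open>The Bayesian order as a family of pairwise comparisons\<close>

text \<open>
  When the entries \<open>i\<close> and \<open>j\<close> are not both zero in \<open>x\<close> nor both zero in \<open>y\<close>, this is the second
  clause of the two-dimensional order for the two states obtained by normalizing the pair
  \<open>(j, i)\<close>: index \<open>j\<close> dominates in both states, and more so in \<open>y\<close>. Cross-multiplication
  makes sense of it for zero entries as well.
\<close>

definition ratio_le :: "(nat \<Rightarrow> real) \<Rightarrow> (nat \<Rightarrow> real) \<Rightarrow> nat \<Rightarrow> nat \<Rightarrow> bool" where
  "ratio_le x y i j \<longleftrightarrow> x i \<le> x j \<and> y i \<le> y j \<and> x j * y i \<le> x i * y j"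

definition pairwise_le :: "nat \<Rightarrow> (nat \<Rightarrow> real) \<Rightarrow> (nat \<Rightarrow> real) \<Rightarrow> bool" where
  "pairwise_le n x y \<longleftrightarrow> (\<forall>i\<in>{1..n}. \<forall>j\<in>{1..n}. ratio_le x y i j \<or> ratio_le x y j i)"

text \<open>
  The order-preserving enumeration of the indices other than \<open>i\<close>. It replaces the case distinction in
  the projection, so that sums and quantifiers can be transported along a bijection.
\<close>

definition skip :: "nat \<Rightarrow> nat \<Rightarrow> nat" where
  "skip i j = (if j < i then j else Suc j)"

lemma bayes_proj_skip: "bayes_proj i x j = x (skip i j) / (1 - x i)"
  by (simp add: bayes_proj_def skip_def)

lemma skip_bij_betw:
  assumes "i \<in> {1..Suc n}"
  shows "bij_betw (skip i) {1..n} ({1..Suc n} - {i})"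
proof (rule bij_betw_byWitness[where f' = "\<lambda>k. if k < i then k else k - 1"])
qed (use assms in \<open>auto simp: skip_def\<close>)

lemma bayes_dom_iff:
  assumes "i \<in> {1..n}"
  shows "x \<in> bayes_dom n i \<longleftrightarrow> x \<in> states n \<and> x i < 1"
proof -
  have "x = pure_state i \<longleftrightarrow> \<not> x i < 1" if "x \<in> states n"
  proof -
    have "x i \<le> 1" using that assms by (simp add: states_def)
    then show ?thesis using states_eq_pure[OF that assms] by (auto simp: pure_state_def)
  qed
  then show ?thesis by (auto simp: bayes_dom_def)
qed

lemma bayes_proj_in_states:
  assumes "x \<in> states (Suc n)" "i \<in> {1..Suc n}" "x i < 1"
  shows "bayes_proj i x \<in> states n"
proof (rule statesI)
  show "0 \<le> bayes_proj i x j" for j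
    using states_nonneg[OF assms(1)] assms(3) by (simp add: bayes_proj_skip)
  show "bayes_proj i x j = 0" if "j \<notin> {1..n}" for j
    using that assms by (auto simp: bayes_proj_def states_def)
  have "(\<Sum>j=1..n. bayes_proj i x j) = (\<Sum>j=1..n. x (skip i j)) / (1 - x i)"
    by (simp add: bayes_proj_skip sum_divide_distrib)
  also have "(\<Sum>j=1..n. x (skip i j)) = (\<Sum>k\<in>{1..Suc n} - {i}. x k)"
    by (rule sum.reindex_bij_betw[OF skip_bij_betw[OF assms(2)]])
  also have "\<dots> = 1 - x i"
    using sum.remove[of "{1..Suc n}" i x] assms states_sum[OF assms(1)] by simp
  finally show "(\<Sum>j=1..n. bayes_proj i x j) = 1" using assms by simp
qed

lemma ratio_le_bayes_proj:
  assumes "x i < 1" "y i < 1"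
  shows "ratio_le (bayes_proj i x) (bayes_proj i y) j k
           \<longleftrightarrow> ratio_le x y (skip i j) (skip i k)"
  using assms by (simp add: ratio_le_def bayes_proj_skip divide_simps)

text \<open>
  The relation \<open>ratio_le\<close> is insensitive to rescaling, so a projection along \<open>i\<close> tests exactly the pairs
  that avoid \<open>i\<close>. In dimension at least 3 every pair avoids some \<open>i\<close>. The projection along this \<open>i\<close> is
  unavailable only if one of the two states is \<open>e\<^sub>i\<close>; then both entries of the pair vanish in that
  state, and the comparison of the pair holds trivially.
\<close>

lemma bayes_le_iff_pairwise:
  assumes "2 \<le> n" "x \<in> states n" "y \<in> states n"
  shows "bayes_le n x y \<longleftrightarrow> pairwise_le n x y"
  using assms
proof (induction n arbitrary: x y rule: nat_induct_at_least[where m=2])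
  case base
  have two: "{1..2} = {1, 2::nat}" by auto
  have x: "x 2 = 1 - x 1" and y: "y 2 = 1 - y 1"
    using states_sum[OF base(1)] states_sum[OF base(2)] unfolding two by simp_all
  have refl: "ratio_le x y i i" for i by (simp add: ratio_le_def mult.commute)
  have "ratio_le x y 1 2 \<longleftrightarrow> y 1 \<le> x 1 \<and> x 1 \<le> 1/2"
    and "ratio_le x y 2 1 \<longleftrightarrow> 1/2 \<le> x 1 \<and> x 1 \<le> y 1"
    unfolding ratio_le_def x y by (auto simp: algebra_simps)
  moreover have "bayes_le 2 x y \<longleftrightarrow> (y 1 \<le> x 1 \<and> x 1 \<le> 1/2) \<or> (1/2 \<le> x 1 \<and> x 1 \<le> y 1)"
    by (simp add: numeral_2_eq_2)
  moreover have "pairwise_le 2 x y \<longleftrightarrow> ratio_le x y 1 2 \<or> ratio_le x y 2 1"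
    unfolding pairwise_le_def two using refl by blast
  ultimately show ?case by blast
next
  case (Suc n)
  then obtain m where m: "n = Suc (Suc m)"
    by (metis numeral_2_eq_2 Suc_le_D Suc_le_mono)
  have proj: "bayes_le n (bayes_proj i x) (bayes_proj i y)
      \<longleftrightarrow> (\<forall>j\<in>{1..Suc n} - {i}. \<forall>k\<in>{1..Suc n} - {i}. ratio_le x y j k \<or> ratio_le x y k j)"
    if i: "i \<in> {1..Suc n}" "x i < 1" "y i < 1" for i
  proof -
    have "bayes_le n (bayes_proj i x) (bayes_proj i y)
        \<longleftrightarrow> pairwise_le n (bayes_proj i x) (bayes_proj i y)"
      using Suc.IH Suc.prems bayes_proj_in_states i by blast
    also have "\<dots> \<longleftrightarrow> (\<forall>j\<in>skip i ` {1..n}. \<forall>k\<in>skip i ` {1..n}.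
        ratio_le x y j k \<or> ratio_le x y k j)"
      using i by (simp add: pairwise_le_def ratio_le_bayes_proj)
    finally show ?thesis
      by (simp only: bij_betw_imp_surj_on[OF skip_bij_betw[OF i(1)]])
  qed
  have "bayes_le (Suc n) x y \<longleftrightarrow> (\<forall>i\<in>{1..Suc n}. x i < 1 \<and> y i < 1 \<longrightarrow>
      (\<forall>j\<in>{1..Suc n} - {i}. \<forall>k\<in>{1..Suc n} - {i}. ratio_le x y j k \<or> ratio_le x y k j))"
    using Suc.prems proj by (auto simp: m bayes_dom_iff simp del: One_nat_def)
  also have "\<dots> \<longleftrightarrow> pairwise_le (Suc n) x y"
  proof
    assume *: "\<forall>i\<in>{1..Suc n}. x i < 1 \<and> y i < 1 \<longrightarrow>
      (\<forall>j\<in>{1..Suc n} - {i}. \<forall>k\<in>{1..Suc n} - {i}. ratio_le x y j k \<or> ratio_le x y k j)"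
    have "ratio_le x y j k \<or> ratio_le x y k j" if jk: "j \<in> {1..Suc n}" "k \<in> {1..Suc n}" for j k
    proof -
      have "card {j, k} < card {1..Suc n}"
        using Suc.hyps card_insert_le_m1[of 2 "{k}" j] by auto
      then have "\<not> {1..Suc n} \<subseteq> {j, k}" by (metis card_mono finite.emptyI finite.insertI leD)
      then obtain i where i: "i \<in> {1..Suc n}" "i \<noteq> j" "i \<noteq> k" by blast
      show ?thesis
      proof (cases "x i < 1 \<and> y i < 1")
        case True
        then show ?thesis using * i jk by blast
      next
        case False
        moreover have "x i \<le> 1" "y i \<le> 1" using Suc.prems i(1) by (simp_all add: states_def)
        ultimately have "x i = 1 \<or> y i = 1" by auto
        then have "x = pure_state i \<or> y = pure_state i"
          using states_eq_pure Suc.prems i(1) by blast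
        then show ?thesis using i by (auto simp: ratio_le_def pure_state_def)
      qed
    qed
    then show "pairwise_le (Suc n) x y" by (simp add: pairwise_le_def)
  qed (auto simp: pairwise_le_def)
  finally show ?case .
qed

lemma pairwise_leD:
  assumes "pairwise_le n x y" "i \<in> {1..n}" "j \<in> {1..n}" "x i < x j \<or> y i < y j"
  shows "ratio_le x y i j"
  using assms by (fastforce simp: pairwise_le_def ratio_le_def)

text \<open>
  A positive entry \<open>x k\<close> dominates the zero entry \<open>x i\<close>, and the dominance can only grow. This is what
  excludes pathologies caused by pairs of zero entries, on which the pairwise condition is void.
\<close>

lemma pairwise_le_zero:
  assumes "pairwise_le n x y" "x \<in> states n" "y \<in> states n" "i \<in> {1..n}" "x i = 0"
  shows "y i = 0"
proof -
  obtain k where k: "k \<in> {1..n}" "0 < x k" using states_pos_entry[OF assms(2)] .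
  then have "ratio_le x y i k" using pairwise_leD[of n x y i k] assms by simp
  then have "x k * y i \<le> 0" using assms by (simp add: ratio_le_def)
  then show ?thesis using k states_nonneg[OF assms(3), of i]
    by (metis mult_le_0_iff order_antisym not_less)
qed

lemma pairwise_le_refl: "pairwise_le n x x"
  by (auto simp: pairwise_le_def ratio_le_def mult.commute)

lemma pairwise_le_antisym:
  assumes "pairwise_le n x y" "pairwise_le n y x" "x \<in> states n" "y \<in> states n"
  shows "x = y"
proof
  fix i
  have cross: "x i * y j = x j * y i" if ij: "i \<in> {1..n}" "j \<in> {1..n}" for i j
  proof -
    have less: "x i * y j = x j * y i" if "x i < x j \<or> y i < y j" "i \<in> {1..n}" "j \<in> {1..n}" for i j
      using pairwise_leD[OF assms(1), of i j] pairwise_leD[OF assms(2), of i j] that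
      by (auto simp: ratio_le_def mult.commute)
    show ?thesis
      using less[of i j] less[of j i] ij by (cases "x i = x j \<and> y i = y j") fastforce+
  qed
  show "x i = y i"
  proof (cases "i \<in> {1..n}")
    case True
    have "x i = (\<Sum>j=1..n. x i * y j)"
      using states_sum[OF assms(4)] by (simp flip: sum_distrib_left)
    also have "\<dots> = (\<Sum>j=1..n. x j * y i)" using cross True by (intro sum.cong) auto
    also have "\<dots> = y i" using states_sum[OF assms(3)] by (simp flip: sum_distrib_right)
    finally show ?thesis .
  qed (use assms in \<open>auto simp: states_def\<close>)
qed

text \<open>
  If the middle state separates the pair, its order is forced on the outer states and the two
  ratio inequalities multiply. If it does not separate the pair, then either the common entry is
  positive, and \<open>x\<close> cannot separate the pair either, or it is zero, and both entries of \<open>z\<close> vanish.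
\<close>

lemma pairwise_le_trans:
  assumes xy: "pairwise_le n x y" and yz: "pairwise_le n y z"
    and st: "x \<in> states n" "y \<in> states n" "z \<in> states n"
  shows "pairwise_le n x z"
proof -
  have less: "ratio_le x z i j" if "y i < y j" and ij: "i \<in> {1..n}" "j \<in> {1..n}" for i j
  proof -
    have r: "ratio_le x y i j" "ratio_le y z i j"
      using pairwise_leD[OF xy ij] pairwise_leD[OF yz ij] that by auto
    have "(x j * z i) * y j = x j * (y j * z i)" by simp
    also have "\<dots> \<le> x j * (y i * z j)"
      using r states_nonneg[OF st(1)] by (intro mult_left_mono) (auto simp: ratio_le_def)
    also have "\<dots> = (x j * y i) * z j" by simp
    also have "\<dots> \<le> (x i * y j) * z j"
      using r states_nonneg[OF st(3)] by (intro mult_right_mono) (auto simp: ratio_le_def)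
    finally have "(x j * z i) * y j \<le> (x i * z j) * y j" by (simp add: mult_ac)
    moreover have "0 < y j" using that states_nonneg[OF st(2), of i] by linarith
    ultimately show ?thesis using r by (auto simp: ratio_le_def)
  qed
  have "ratio_le x z i j \<or> ratio_le x z j i" if ij: "i \<in> {1..n}" "j \<in> {1..n}" for i j
  proof -
    consider "y i < y j" | "y j < y i" | "y i = y j" "y i = 0" | "y i = y j" "0 < y i"
      using states_nonneg[OF st(2), of i] by linarith
    then show ?thesis
    proof cases
      case 3
      then have "z i = 0" "z j = 0" using pairwise_le_zero[OF yz st(2,3)] ij by auto
      then show ?thesis by (auto simp: ratio_le_def)
    next
      case 4
      then have "x i = x j" proof -
        have eq: "x k = x l" if "ratio_le x y k l" "y k = y l" "0 < y k" for k l
          using that by (auto simp: ratio_le_def)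
        have "ratio_le x y i j \<or> ratio_le x y j i" using xy ij unfolding pairwise_le_def by blast
        then show ?thesis using eq[of i j] eq[of j i] 4 by auto
      qed
      then show ?thesis
        using states_nonneg[OF st(1), of j] by (auto simp: ratio_le_def intro: mult_left_mono)
    qed (use less ij in blast)+
  qed
  then show ?thesis by (simp add: pairwise_le_def)
qed

lemma carrier_bayes_order [simp]: "carrier (bayes_order n) = states n"
  by (simp add: bayes_order_def)

lemma bayes_order_le:
  assumes "2 \<le> n" "x \<in> states n" "y \<in> states n"
  shows "x \<sqsubseteq>\<^bsub>bayes_order n\<^esub> y \<longleftrightarrow> pairwise_le n x y"
  using bayes_le_iff_pairwise[OF assms] by (simp add: bayes_order_def)

lemma partial_order_bayes:
  assumes "2 \<le> n"
  shows "partial_order (bayes_order n)"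
proof
  fix x y z w
  assume st: "x \<in> carrier (bayes_order n)" "y \<in> carrier (bayes_order n)"
  assume "x .=\<^bsub>bayes_order n\<^esub> y" "z .=\<^bsub>bayes_order n\<^esub> w"
  then show "(x \<sqsubseteq>\<^bsub>bayes_order n\<^esub> z) = (y \<sqsubseteq>\<^bsub>bayes_order n\<^esub> w)" by (simp add: bayes_order_def)
next
  fix x assume "x \<in> carrier (bayes_order n)"
  then show "x \<sqsubseteq>\<^bsub>bayes_order n\<^esub> x" using assms by (simp add: bayes_order_le pairwise_le_refl)
next
  fix x y
  assume "x \<in> carrier (bayes_order n)" "y \<in> carrier (bayes_order n)"
    "x \<sqsubseteq>\<^bsub>bayes_order n\<^esub> y" "y \<sqsubseteq>\<^bsub>bayes_order n\<^esub> x"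
  then show "x .=\<^bsub>bayes_order n\<^esub> y"
    using assms pairwise_le_antisym[of n x y] by (simp add: bayes_order_le) (simp add: bayes_order_def)
next
  fix x y z
  assume "x \<in> carrier (bayes_order n)" "y \<in> carrier (bayes_order n)" "z \<in> carrier (bayes_order n)"
    "x \<sqsubseteq>\<^bsub>bayes_order n\<^esub> y" "y \<sqsubseteq>\<^bsub>bayes_order n\<^esub> z"
  then show "x \<sqsubseteq>\<^bsub>bayes_order n\<^esub> z"
    using assms pairwise_le_trans[of n x y z] by (simp add: bayes_order_le)
qed (auto simp: bayes_order_def)

text \<open>
  The relation is a finite conjunction of disjunctions of two closed conditions. For a given pair one of
  the two disjuncts holds infinitely often, and it survives the limit along that subsequence.
\<close>

lemma pairwise_le_tendsto:
  assumes "\<And>m. pairwise_le n (x m) (y m)"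
    and "\<And>i. (\<lambda>m. x m i) \<longlonglongrightarrow> x' i" "\<And>i. (\<lambda>m. y m i) \<longlonglongrightarrow> y' i"
  shows "pairwise_le n x' y'"
proof -
  have freq: "ratio_le x' y' i j" if fr: "\<exists>\<^sub>F m in sequentially. ratio_le (x m) (y m) i j" for i j
  proof -
    obtain r :: "nat \<Rightarrow> nat" where r: "strict_mono r" "\<And>m. ratio_le (x (r m)) (y (r m)) i j"
      using fr infinite_enumerate[of "{m. ratio_le (x m) (y m) i j}"]
      by (auto simp: cofinite_eq_sequentially[symmetric] frequently_cofinite)
    have x: "(\<lambda>m. x (r m) k) \<longlonglongrightarrow> x' k" and y: "(\<lambda>m. y (r m) k) \<longlonglongrightarrow> y' k" for k
      using LIMSEQ_subseq_LIMSEQ[OF assms(2) r(1), of k]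
        LIMSEQ_subseq_LIMSEQ[OF assms(3) r(1), of k] by (simp_all add: o_def)
    show ?thesis unfolding ratio_le_def
    proof (intro conjI)
      show "x' i \<le> x' j" using r(2) by (intro LIMSEQ_le[OF x x]) (auto simp: ratio_le_def)
      show "y' i \<le> y' j" using r(2) by (intro LIMSEQ_le[OF y y]) (auto simp: ratio_le_def)
      show "x' j * y' i \<le> x' i * y' j"
        using r(2) by (intro LIMSEQ_le[OF tendsto_mult[OF x y] tendsto_mult[OF x y]])
          (auto simp: ratio_le_def)
    qed
  qed
  show ?thesis unfolding pairwise_le_def
  proof (intro ballI)
    fix i j assume "i \<in> {1..n}" "j \<in> {1..n}"
    then have "\<exists>\<^sub>F m in sequentially. ratio_le (x m) (y m) i j \<or> ratio_le (x m) (y m) j i"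
      using assms(1) by (simp add: pairwise_le_def)
    then show "ratio_le x' y' i j \<or> ratio_le x' y' j i"
      using freq by (auto simp: frequently_disj_iff)
  qed
qed

section \<open>Suprema of directed sets of states\<close>

definition peaks :: "nat \<Rightarrow> (nat \<Rightarrow> real) \<Rightarrow> nat set" where
  "peaks n x = {k \<in> {1..n}. \<forall>j\<in>{1..n}. x j \<le> x k}"

lemma peaks_nonempty:
  assumes "1 \<le> n"
  shows "peaks n x \<noteq> {}"
proof -
  have "Max (x ` {1..n}) \<in> x ` {1..n}" using assms by (intro Max_in) auto
  then obtain k where "k \<in> {1..n}" "x k = Max (x ` {1..n})" by auto
  then have "k \<in> peaks n x" by (simp add: peaks_def)
  then show ?thesis by blast
qed

lemma peaks_pos:
  assumes "x \<in> states n" "k \<in> peaks n x"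
  shows "0 < x k"
proof -
  obtain j where "j \<in> {1..n}" "0 < x j" using states_pos_entry[OF assms(1)] .
  then show ?thesis using assms(2) by (force simp: peaks_def)
qed

text \<open>
  Going up, a strict order between two entries can only be sharpened, so no new index can become
  maximal. This is why a directed set of states has a common maximal index.
\<close>

lemma peaks_antimono:
  assumes "pairwise_le n x y" "x \<in> states n" "y \<in> states n"
  shows "peaks n y \<subseteq> peaks n x"
proof
  fix k assume k: "k \<in> peaks n y"
  have "x j \<le> x k" if j: "j \<in> {1..n}" for j
  proof (rule ccontr)
    assume less: "\<not> ?thesis"
    then have "ratio_le x y k j" using pairwise_leD[OF assms(1), of k j] k j by (simp add: peaks_def)
    then have "y j = y k" "x j * y k \<le> x k * y j" using k j by (auto simp: ratio_le_def peaks_def intro: antisym)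
    then show False using less peaks_pos[OF assms(3) k] by simp
  qed
  then show "k \<in> peaks n x" using k by (simp add: peaks_def)
qed

text \<open>
  Monotone coordinates for the order: after division by the entry at a common peak, all
  entries decrease along the order. Directed suprema are computed in these coordinates.
\<close>

lemma peak_ratio_antimono:
  assumes "pairwise_le n x y" "x \<in> states n" "y \<in> states n" "k \<in> peaks n y" "j \<in> {1..n}"
  shows "y j / y k \<le> x j / x k"
proof -
  have kx: "k \<in> peaks n x" using peaks_antimono[OF assms(1-3)] assms(4) by blast
  have pos: "0 < x k" "0 < y k" using peaks_pos assms kx by blast+
  have "ratio_le x y j k \<or> ratio_le x y k j"
    using assms by (auto simp: pairwise_le_def peaks_def)
  then show ?thesis
  proof
    assume "ratio_le x y j k"
    then show ?thesis using pos by (simp add: ratio_le_def divide_simps mult_ac)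
  next
    assume "ratio_le x y k j"
    then have "x j = x k" "y j = y k" using assms(4,5) kx by (auto simp: ratio_le_def peaks_def intro: antisym)
    then show ?thesis using pos by simp
  qed
qed

lemma directed_bayesD:
  assumes "2 \<le> n" "directed (bayes_order n) S"
  shows "S \<subseteq> states n" "S \<noteq> {}"
    "\<And>x y. x \<in> S \<Longrightarrow> y \<in> S \<Longrightarrow> \<exists>z\<in>S. pairwise_le n x z \<and> pairwise_le n y z"
proof -
  show S: "S \<subseteq> states n" and "S \<noteq> {}" using assms(2) by (auto simp: directed_def)
  fix x y assume "x \<in> S" "y \<in> S"
  then obtain z where "z \<in> S" "x \<sqsubseteq>\<^bsub>bayes_order n\<^esub> z" "y \<sqsubseteq>\<^bsub>bayes_order n\<^esub> z"
    using assms(2) unfolding directed_def by blast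
  then show "\<exists>z\<in>S. pairwise_le n x z \<and> pairwise_le n y z"
    using S \<open>x \<in> S\<close> \<open>y \<in> S\<close> bayes_order_le[OF assms(1)] by blast
qed

lemma directed_finite_bound:
  assumes "2 \<le> n" "directed (bayes_order n) S" "finite F" "F \<subseteq> S"
  shows "\<exists>z\<in>S. \<forall>x\<in>F. pairwise_le n x z"
  using assms(3,4)
proof (induction F)
  case empty
  then show ?case using directed_bayesD(2)[OF assms(1,2)] by auto
next
  case (insert w F)
  then obtain z where z: "z \<in> S" "\<forall>x\<in>F. pairwise_le n x z" by auto
  obtain v where v: "v \<in> S" "pairwise_le n w v" "pairwise_le n z v"
    using directed_bayesD(3)[OF assms(1,2), of w z] insert.prems z by auto
  have "pairwise_le n x v" if "x \<in> F" for x
    using pairwise_le_trans[of n x z v] that z v insert.prems directed_bayesD(1)[OF assms(1,2)]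
    by blast
  then show ?case using v by auto
qed

text \<open>
  The sets of peaks form a family of finite nonempty sets that is directed downwards, so one of least
  cardinality is contained in all of them.
\<close>

lemma directed_common_peak:
  assumes "2 \<le> n" "directed (bayes_order n) S"
  obtains k where "\<And>x. x \<in> S \<Longrightarrow> k \<in> peaks n x"
proof -
  note S = directed_bayesD[OF assms]
  obtain x0 where x0: "x0 \<in> S" "\<And>x. x \<in> S \<Longrightarrow> card (peaks n x0) \<le> card (peaks n x)"
    using ex_has_least_nat[of "\<lambda>x. x \<in> S" _ "\<lambda>x. card (peaks n x)"] S(2) by blast
  obtain k where k: "k \<in> peaks n x0" using peaks_nonempty[of n x0] assms(1) by auto
  have "k \<in> peaks n x" if xS: "x \<in> S" for x
  proof -
    obtain z where z: "z \<in> S" "pairwise_le n x z" "pairwise_le n x0 z"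
      using S(3)[OF xS x0(1)] by blast
    have "peaks n z \<subseteq> peaks n x0" "peaks n z \<subseteq> peaks n x"
      using peaks_antimono z xS x0(1) S(1) by blast+
    moreover have "finite (peaks n x0)" by (simp add: peaks_def)
    ultimately show ?thesis using card_seteq x0(2)[OF z(1)] k by blast
  qed
  then show ?thesis using that by blast
qed

text \<open>
  The candidate for the supremum is the state whose entries are proportional to the infima \<open>r j\<close> of
  the ratios \<open>x j / x k\<close> at a common peak \<open>k\<close>. Since the ratios decrease along the order and \<open>S\<close> is
  directed, all of these infima are approached simultaneously by a sequence in \<open>S\<close>, even above
  a prescribed element. Replacing nets by such sequences makes the closedness of the order applicable.
\<close>

lemma directed_limit:
  assumes "2 \<le> n" "directed (bayes_order n) S"
  obtains s where "s \<in> states n"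
    "\<And>x. x \<in> S \<Longrightarrow> \<exists>y. (\<forall>m. y m \<in> S \<and> pairwise_le n x (y m)) \<and> (\<forall>i. (\<lambda>m. y m i) \<longlonglongrightarrow> s i)"
proof -
  note S = directed_bayesD[OF assms]
  obtain k where k: "\<And>x. x \<in> S \<Longrightarrow> k \<in> peaks n x" using directed_common_peak[OF assms] by blast
  have kn: "k \<in> {1..n}" using k S(2) by (auto simp: peaks_def)
  have pos: "0 < x k" if "x \<in> S" for x using peaks_pos k S(1) that by blast
  have nonneg: "0 \<le> x j / x k" if "x \<in> S" for x j
    using pos[OF that] states_nonneg[of x n j] S(1) that by auto
  have bdd: "bdd_below ((\<lambda>x. x j / x k) ` S)" for j using nonneg by (rule bdd_belowI2)
  define r where "r j = (INF x\<in>S. x j / x k)" for j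
  define W where "W = (\<Sum>j=1..n. r j)"
  define s where "s j = (if j \<in> {1..n} then r j / W else 0)" for j
  have r0: "0 \<le> r j" for j unfolding r_def using nonneg S(2) by (intro cINF_greatest) auto
  have "(\<lambda>x. x k / x k) ` S = {1}" using pos S(2) by (auto simp: image_iff) (metis divide_self less_irrefl)+
  then have "r k = 1" by (simp add: r_def)
  then have W: "0 < W" using member_le_sum[of k "{1..n}" r] kn r0 by (auto simp: W_def)
  have s: "s \<in> states n"
  proof (rule statesI)
    have "(\<Sum>i=1..n. s i) = (\<Sum>i=1..n. r i / W)" by (rule sum.cong) (auto simp: s_def)
    then show "(\<Sum>i=1..n. s i) = 1" using W by (simp add: W_def flip: sum_divide_distrib)
  qed (use r0 W in \<open>auto simp: s_def\<close>)
  have "\<exists>y. (\<forall>m. y m \<in> S \<and> pairwise_le n x (y m)) \<and> (\<forall>i. (\<lambda>m. y m i) \<longlonglongrightarrow> s i)" if x: "x \<in> S" for x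
  proof -
    have "\<exists>z\<in>S. pairwise_le n x z \<and> (\<forall>j\<in>{1..n}. z j / z k < r j + inverse (real (Suc m)))" for m
    proof -
      have "\<exists>w\<in>S. w j / w k < r j + inverse (real (Suc m))" for j
      proof -
        have "(INF x\<in>S. x j / x k) < r j + inverse (real (Suc m))" by (simp add: r_def)
        then show ?thesis using cINF_less_iff[OF S(2) bdd] by blast
      qed
      then obtain w where w: "\<And>j. w j \<in> S" "\<And>j. w j j / w j k < r j + inverse (real (Suc m))"
        by metis
      obtain z where z: "z \<in> S" "\<forall>v\<in>insert x (w ` {1..n}). pairwise_le n v z"
        using directed_finite_bound[OF assms, of "insert x (w ` {1..n})"] x w(1) by auto
      have "z j / z k < r j + inverse (real (Suc m))" if "j \<in> {1..n}" for j
      proof -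
        have "z j / z k \<le> w j j / w j k"
          using z w(1)[of j] S(1) k that by (intro peak_ratio_antimono[of n]) auto
        then show ?thesis using w(2)[of j] by linarith
      qed
      then show ?thesis using z by blast
    qed
    then obtain y where y: "\<And>m. y m \<in> S" "\<And>m. pairwise_le n x (y m)"
      "\<And>m j. j \<in> {1..n} \<Longrightarrow> y m j / y m k < r j + inverse (real (Suc m))" by metis
    have lim_r: "(\<lambda>m. y m j / y m k) \<longlonglongrightarrow> r j" if "j \<in> {1..n}" for j
    proof (rule tendsto_sandwich[OF _ _ tendsto_const LIMSEQ_inverse_real_of_nat_add])
      show "\<forall>\<^sub>F m in sequentially. r j \<le> y m j / y m k"
        unfolding r_def using y(1) bdd by (intro always_eventually allI cINF_lower) auto
      show "\<forall>\<^sub>F m in sequentially. y m j / y m k \<le> r j + inverse (real (Suc m))"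
        using y(3) that by (intro always_eventually allI less_imp_le) auto
    qed
    have "(\<lambda>m. y m i) \<longlonglongrightarrow> s i" for i
    proof (cases "i \<in> {1..n}")
      case True
      have eq: "y m i = (y m i / y m k) / (\<Sum>j=1..n. y m j / y m k)" for m
      proof -
        have "(\<Sum>j=1..n. y m j / y m k) = 1 / y m k"
          using states_sum[of "y m" n] S(1) y(1)[of m] by (auto simp flip: sum_divide_distrib)
        then show ?thesis using pos[OF y(1)[of m]] by simp
      qed
      have "(\<lambda>m. (y m i / y m k) / (\<Sum>j=1..n. y m j / y m k)) \<longlonglongrightarrow> r i / W"
        unfolding W_def using lim_r True W
        by (intro tendsto_divide tendsto_sum) (auto simp: W_def)
      then show ?thesis using True eq by (simp add: s_def)
    next
      case False
      then have "y m i = 0" for m using y(1)[of m] S(1) by (auto simp: states_def)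
      moreover have "s i = 0" using False by (auto simp: s_def)
      ultimately show ?thesis by simp
    qed
    then show ?thesis using y by blast
  qed
  then show ?thesis using that s by blast
qed

text \<open>
  Both halves follow from closedness of the order: a fixed \<open>x\<close> lies below the sequence chosen above
  it, and any upper bound of \<open>S\<close> lies above such a sequence.
\<close>

lemma is_lub_limit:
  assumes n: "2 \<le> n" and S: "directed (bayes_order n) S" and s: "s \<in> states n"
    and lim: "\<And>x. x \<in> S \<Longrightarrow>
      \<exists>y. (\<forall>m. y m \<in> S \<and> pairwise_le n x (y m)) \<and> (\<forall>i. (\<lambda>m. y m i) \<longlonglongrightarrow> s i)"
  shows "is_lub (bayes_order n) s S"
proof -
  note SD = directed_bayesD[OF n S]
  have "pairwise_le n x s" if x: "x \<in> S" for x
  proof -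
    obtain y where "\<And>m. y m \<in> S" "\<And>m. pairwise_le n x (y m)" "\<And>i. (\<lambda>m. y m i) \<longlonglongrightarrow> s i"
      using lim[OF x] by blast
    then show ?thesis using pairwise_le_tendsto[of n "\<lambda>_. x" y x s] by simp
  qed
  moreover have "pairwise_le n s u" if u: "\<And>x. x \<in> S \<Longrightarrow> pairwise_le n x u" for u
  proof -
    obtain x where "x \<in> S" using SD(2) by blast
    then obtain y where "\<And>m. y m \<in> S" "\<And>i. (\<lambda>m. y m i) \<longlonglongrightarrow> s i" using lim by blast
    then show ?thesis using pairwise_le_tendsto[of n y "\<lambda>_. u" s u] u by simp
  qed
  ultimately show ?thesis
    using SD(1) s by (auto simp: least_def Upper_def bayes_order_le[OF n] subset_iff)
qed

lemma dcpo_bayes: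
  assumes "2 \<le> n"
  shows "dcpo (bayes_order n)"
proof -
  interpret partial_order "bayes_order n" by (rule partial_order_bayes[OF assms])
  show ?thesis
  proof
    fix S assume S: "directed (bayes_order n) S"
    show "\<exists>s. is_lub (bayes_order n) s S"
      using directed_limit[OF assms S] is_lub_limit[OF assms S] by metis
  qed
qed

lemma sup_eq_lub:
  assumes "partial_order L" "is_lub L s S"
  shows "\<Squnion>\<^bsub>L\<^esub>S = s"
  unfolding sup_def using assms by (intro some_equality) (auto intro: partial_order.least_unique)

section \<open>The ratio of the two largest entries\<close>

lemma last_sort_eq_Max:
  fixes xs :: "real list"
  assumes "xs \<noteq> []"
  shows "last (sort xs) = Max (set xs)"
proof (rule Max_eqI[symmetric])
  have ne: "sort xs \<noteq> []" using assms by (metis length_sort length_0_conv)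
  show "last (sort xs) \<in> set xs" using last_in_set[OF ne] by simp
  fix z assume "z \<in> set xs"
  then obtain i where "i < length (sort xs)" "z = sort xs ! i"
    by (metis set_sort in_set_conv_nth)
  then show "z \<le> last (sort xs)"
    using ne by (auto simp: last_conv_nth intro!: sorted_nth_mono)
qed simp

lemma others_nonempty:
  assumes "2 \<le> (n::nat)"
  shows "{1..n} - {k} \<noteq> {}"
proof -
  have "(if k = 1 then 2 else 1) \<in> {1..n} - {k}" using assms by auto
  then show ?thesis by blast
qed

lemma sort_desc_peak:
  assumes "2 \<le> n" "k \<in> peaks n x"
  shows "sort_desc n x 1 = x k" "sort_desc n x 2 = Max (x ` ({1..n} - {k}))"
proof -
  define ys where "ys = map x (remove1 k [1..<Suc n])"
  have set_rem: "set (remove1 k [1..<Suc n]) = {1..n} - {k}" by auto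
  have k: "k \<in> {1..n}" "\<forall>j\<in>{1..n}. x j \<le> x k" using assms by (auto simp: peaks_def)
  have "mset (map x [1..<Suc n]) = image_mset x (mset (k # remove1 k [1..<Suc n]))"
    using k(1) by (simp add: insert_DiffM del: upt_Suc flip: image_mset_add_mset)
  then have "mset (map x [1..<Suc n]) = mset (x k # ys)" by (simp add: ys_def del: upt_Suc)
  then have "sort (map x [1..<Suc n]) = sort (x k # ys)"
    by (intro properties_for_sort) (simp_all only: mset_sort sorted_sort)
  also have "\<dots> = sort ys @ [x k]"
    using k(2) set_rem by (auto simp: ys_def intro!: sorted_insort_is_snoc simp del: upt_Suc)
  finally have sort: "rev (sort (map x [1..<Suc n])) = x k # rev (sort ys)" by simp
  then show "sort_desc n x 1 = x k" by (simp add: sort_desc_def del: upt_Suc)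
  have set_ys: "set ys = x ` ({1..n} - {k})" unfolding ys_def set_map set_rem ..
  then have "ys \<noteq> []" using others_nonempty[OF assms(1), of k] by (metis image_is_empty set_empty)
  then have "sort ys \<noteq> []" by (metis length_0_conv length_sort)
  then have "sort_desc n x 2 = last (sort ys)"
    using sort by (simp add: sort_desc_def hd_rev flip: hd_conv_nth del: upt_Suc)
  also have "\<dots> = Max (x ` ({1..n} - {k}))"
    using last_sort_eq_Max[OF \<open>ys \<noteq> []\<close>] set_ys by simp
  finally show "sort_desc n x 2 = Max (x ` ({1..n} - {k}))" .
qed

text \<open>
  The reciprocal of the quotient in \<open>ell\<close>: pure states, where \<open>ell\<close> is infinite, are then those with
  value 0, and the function stays bounded and continuous along directed limits.
\<close>

definition gap_ratio :: "nat \<Rightarrow> (nat \<Rightarrow> real) \<Rightarrow> real" where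
  "gap_ratio n x = sort_desc n x 2 / sort_desc n x 1"

text \<open>
  This form does not refer to sorting, and for states with a common peak \<open>k\<close> it is a maximum of the
  monotone coordinates, with \<open>k\<close> fixed. Monotonicity and continuity are read off from it.
\<close>

lemma gap_ratio_peak:
  assumes "2 \<le> n" "x \<in> states n" "k \<in> peaks n x"
  shows "gap_ratio n x = Max ((\<lambda>j. x j / x k) ` ({1..n} - {k}))"
proof -
  have "mono (\<lambda>t. t / x k)"
    using peaks_pos[OF assms(2,3)] by (intro monoI) (simp add: divide_right_mono)
  then have "Max (x ` ({1..n} - {k})) / x k = Max ((\<lambda>t. t / x k) ` x ` ({1..n} - {k}))"
    using others_nonempty[OF assms(1)] by (intro mono_Max_commute) auto
  then show ?thesis using sort_desc_peak[OF assms(1,3)] by (simp add: gap_ratio_def image_image)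
qed

lemma gap_ratio_bounds:
  assumes "2 \<le> n" "x \<in> states n"
  shows "0 \<le> gap_ratio n x" "gap_ratio n x \<le> 1" "is_pure n x \<longleftrightarrow> gap_ratio n x = 0"
proof -
  obtain k where k: "k \<in> peaks n x" using peaks_nonempty[of n x] assms by auto
  define J where "J = {1..n} - {k}"
  have fin: "finite J" and ne: "J \<noteq> {}" using others_nonempty[OF assms(1)] by (auto simp: J_def)
  have q: "gap_ratio n x = Max ((\<lambda>j. x j / x k) ` J)"
    unfolding J_def by (rule gap_ratio_peak[OF assms k])
  have pos: "0 < x k" by (rule peaks_pos[OF assms(2) k])
  have kn: "k \<in> {1..n}" "\<And>j. j \<in> J \<Longrightarrow> x j \<le> x k" using k by (auto simp: peaks_def J_def)
  have nonneg: "0 \<le> x j / x k" for j using states_nonneg[OF assms(2)] pos by simp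
  obtain j0 where j0: "j0 \<in> J" using ne by blast
  have ge: "x j / x k \<le> gap_ratio n x" if "j \<in> J" for j unfolding q using that fin by (intro Max_ge) auto
  show q0: "0 \<le> gap_ratio n x" using ge[OF j0] nonneg[of j0] by linarith
  show "gap_ratio n x \<le> 1" using q fin ne kn(2) pos by simp
  show "is_pure n x \<longleftrightarrow> gap_ratio n x = 0"
  proof
    assume "is_pure n x"
    then obtain i where i: "i \<in> {1..n}" "x i = 1" by (auto simp: is_pure_def)
    then have x: "x = pure_state i" using states_eq_pure assms(2) by blast
    then have "i = k" using pos by (auto simp: pure_state_def split: if_splits)
    then have "(\<lambda>j. x j / x k) ` J = {0}" using x ne by (auto simp: pure_state_def J_def)
    then show "gap_ratio n x = 0" using q by simp
  next
    assume "gap_ratio n x = 0"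
    then have "x j = 0" if "j \<in> J" for j
      using ge[OF that] nonneg[of j] pos by simp
    then have "(\<Sum>j\<in>{1..n} - {k}. x j) = 0" by (simp add: J_def)
    then have "x k = 1" using sum.remove[of "{1..n}" k x] states_sum[OF assms(2)] kn(1) by simp
    then show "is_pure n x" using kn by (auto simp: is_pure_def)
  qed
qed

lemma gap_ratio_antimono:
  assumes "2 \<le> n" "pairwise_le n x y" "x \<in> states n" "y \<in> states n"
  shows "gap_ratio n y \<le> gap_ratio n x"
proof -
  obtain k where ky: "k \<in> peaks n y" using peaks_nonempty[of n y] assms by auto
  have kx: "k \<in> peaks n x" using peaks_antimono[OF assms(2-4)] ky by blast
  have "y j / y k \<le> Max ((\<lambda>j. x j / x k) ` ({1..n} - {k}))" if "j \<in> {1..n} - {k}" for j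
    using peak_ratio_antimono[OF assms(2-4) ky, of j] that
    by (intro order_trans[OF _ Max_ge[of _ "x j / x k"]]) auto
  then show ?thesis
    unfolding gap_ratio_peak[OF assms(1,4) ky] gap_ratio_peak[OF assms(1,3) kx]
    using others_nonempty[OF assms(1)] by (intro Max.boundedI) blast+
qed

lemma tendsto_Max_image:
  fixes f :: "nat \<Rightarrow> nat \<Rightarrow> real"
  assumes "finite J" "J \<noteq> {}" "\<And>j. j \<in> J \<Longrightarrow> (\<lambda>m. f m j) \<longlonglongrightarrow> g j"
  shows "(\<lambda>m. Max (f m ` J)) \<longlonglongrightarrow> Max (g ` J)"
  using assms by (induction J rule: finite_ne_induct) (auto intro!: tendsto_max)

text \<open>
  A peak of the limit is a peak of all elements below it, so a single index \<open>k\<close> serves the whole sequence.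
\<close>

lemma gap_ratio_tendsto:
  assumes "2 \<le> n" "\<And>m. y m \<in> states n" "s \<in> states n" "\<And>m. pairwise_le n (y m) s"
    and "\<And>i. (\<lambda>m. y m i) \<longlonglongrightarrow> s i"
  shows "(\<lambda>m. gap_ratio n (y m)) \<longlonglongrightarrow> gap_ratio n s"
proof -
  obtain k where ks: "k \<in> peaks n s" using peaks_nonempty[of n s] assms by auto
  have ky: "k \<in> peaks n (y m)" for m using peaks_antimono[OF assms(4,2,3)] ks by blast
  have "s k \<noteq> 0" using peaks_pos[OF assms(3) ks] by simp
  then show ?thesis
    unfolding gap_ratio_peak[OF assms(1,3) ks] gap_ratio_peak[OF assms(1,2) ky]
    using others_nonempty[OF assms(1)] assms(5)
    by (intro tendsto_Max_image tendsto_divide) auto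
qed

section \<open>Gibbs states and maximum entropy\<close>

lemma partition_pos: "1 \<le> n \<Longrightarrow> 0 < (\<Sum>i=1..n. exp (t * a i :: real))" for n :: nat
  by (intro sum_pos) auto

lemma gibbs_pos: "i \<in> {1..n} \<Longrightarrow> 0 < gibbs n a t i"
  using partition_pos[of n t a] by (auto simp: gibbs_def)

lemma gibbs_in_states:
  assumes "1 \<le> n"
  shows "gibbs n a t \<in> states n"
proof (rule statesI)
  show "0 \<le> gibbs n a t i" for i
    using gibbs_pos[of i n a t] by (cases "i \<in> {1..n}") (auto simp: gibbs_def)
  have "(\<Sum>i=1..n. gibbs n a t i) = (\<Sum>i=1..n. exp (t * a i) / (\<Sum>j=1..n. exp (t * a j)))"
    by (rule sum.cong) (auto simp: gibbs_def)
  then show "(\<Sum>i=1..n. gibbs n a t i) = 1"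
    using partition_pos[OF assms, of t a] by (simp flip: sum_divide_distrib)
qed (auto simp: gibbs_def)

lemma mean_gap_eq: "mean_gap n a E t = expect n a (gibbs n a t) - E"
proof -
  have "expect n a (gibbs n a t)
      = (\<Sum>i=1..n. a i * exp (t * a i) / (\<Sum>j=1..n. exp (t * a j)))"
    unfolding expect_def by (rule sum.cong) (auto simp: gibbs_def)
  then show ?thesis by (simp add: mean_gap_def flip: sum_divide_distrib)
qed

lemma ratio_le_gibbs:
  assumes "i \<in> {1..n}" "j \<in> {1..n}"
  shows "ratio_le (gibbs n a s) (gibbs n a t) i j \<longleftrightarrow>
    s * a i \<le> s * a j \<and> t * a i \<le> t * a j \<and> s * a j + t * a i \<le> s * a i + t * a j"
proof -
  define Z where "Z u = (\<Sum>i=1..n. exp (u * a i))" for u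
  have Z: "0 < Z u" for u unfolding Z_def using assms by (intro partition_pos) simp
  then have ZZ: "0 < Z s * Z t" by simp
  have gibbs: "gibbs n a u k = exp (u * a k) / Z u" if "k \<in> {1..n}" for u k
    using that by (simp add: gibbs_def Z_def)
  have "gibbs n a u k \<le> gibbs n a u l \<longleftrightarrow> u * a k \<le> u * a l"
    and "gibbs n a s k * gibbs n a t l \<le> gibbs n a s l * gibbs n a t k
      \<longleftrightarrow> exp (s * a k) * exp (t * a l) \<le> exp (s * a l) * exp (t * a k)"
    if "k \<in> {1..n}" "l \<in> {1..n}" for u k l
    using that Z[of u] ZZ by (simp_all add: gibbs divide_le_cancel order.asym del: mult_le_cancel_left mult_le_cancel_right)
  then show ?thesis using assms by (simp add: ratio_le_def flip: exp_add)
qed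

text \<open>
  The ratio of the entries \<open>i\<close> and \<open>j\<close> is \<open>exp (t * (a i - a j))\<close>. As \<open>t\<close> moves away from 0, on
  either side, none of these ratios moves closer to 1 or to the other side of it.
\<close>

lemma gibbs_mono:
  assumes "0 \<le> s \<and> s \<le> t \<or> t \<le> s \<and> s \<le> 0"
  shows "pairwise_le n (gibbs n a s) (gibbs n a t)"
proof -
  have le: "ratio_le (gibbs n a s) (gibbs n a t) i j \<or> ratio_le (gibbs n a s) (gibbs n a t) j i"
    if ij: "i \<in> {1..n}" "j \<in> {1..n}" and "a i \<le> a j" for i j
    using assms
  proof
    assume st: "0 \<le> s \<and> s \<le> t"
    then have "0 \<le> (t - s) * (a j - a i)" using that by simp
    then have "ratio_le (gibbs n a s) (gibbs n a t) i j"
      unfolding ratio_le_gibbs[OF ij] using st that by (auto simp: algebra_simps mult_left_mono)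
    then show ?thesis ..
  next
    assume st: "t \<le> s \<and> s \<le> 0"
    then have "0 \<le> (s - t) * (a j - a i)" using that by simp
    then have "ratio_le (gibbs n a s) (gibbs n a t) j i"
      unfolding ratio_le_gibbs[OF ij(2,1)] using st that
      by (auto simp: algebra_simps mult_left_mono_neg)
    then show ?thesis ..
  qed
  show ?thesis unfolding pairwise_le_def
  proof (intro ballI)
    fix i j assume "i \<in> {1..n}" "j \<in> {1..n}"
    then show "ratio_le (gibbs n a s) (gibbs n a t) i j \<or> ratio_le (gibbs n a s) (gibbs n a t) j i"
      using le[of i j] le[of j i] linear[of "a i" "a j"] by blast
  qed
qed

text \<open>
  One term of the relative entropy of \<open>x\<close> with respect to \<open>g\<close>. The correction \<open>g - x\<close>, which sums to
  zero over a state, makes each single term nonnegative.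
\<close>

lemma divergence_term_nonneg:
  assumes "0 \<le> x" "0 < (g::real)"
  shows "0 \<le> x * (ln x - ln g) - x + g" "x * (ln x - ln g) - x + g = 0 \<Longrightarrow> x = g"
proof -
  consider "x = 0" | "0 < x" using assms by linarith
  then have "0 \<le> x * (ln x - ln g) - x + g \<and> (x * (ln x - ln g) - x + g = 0 \<longrightarrow> x = g)"
  proof cases
    case 1
    then show ?thesis using assms by simp
  next
    case 2
    have eq: "x * (ln x - ln g) - x + g = x * ((g / x - 1) - ln (g / x))"
      using 2 assms by (simp add: ln_div field_simps)
    have "ln (g / x) \<le> g / x - 1" using 2 assms by (intro ln_le_minus_one) simp
    moreover have "x = g" if "ln (g / x) = g / x - 1"
      using ln_eq_minus_one[of "g / x"] that 2 assms by simp
    ultimately show ?thesis unfolding eq using 2 by auto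
  qed
  then show "0 \<le> x * (ln x - ln g) - x + g" "x * (ln x - ln g) - x + g = 0 \<Longrightarrow> x = g" by auto
qed

text \<open>
  Since \<open>ln\<close> of a Gibbs state \<open>g\<close> is affine in \<open>a\<close>, the cross entropy of \<open>x\<close> with respect to \<open>g\<close> depends
  on \<open>x\<close> only through its expectation. Hence for equal expectations the difference of the entropies
  is the relative entropy, a sum of nonnegative terms that vanishes only for \<open>x = g\<close>.
\<close>

lemma entropy_le_gibbs:
  assumes "1 \<le> n" "x \<in> states n" "expect n a x = expect n a (gibbs n a t)"
  shows "entropy n x \<le> entropy n (gibbs n a t)"
    and "entropy n x = entropy n (gibbs n a t) \<Longrightarrow> x = gibbs n a t"
proof -
  define g where "g = gibbs n a t"
  define Z where "Z = (\<Sum>i=1..n. exp (t * a i))"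
  define D where "D i = x i * (ln (x i) - ln (g i)) - x i + g i" for i
  have Z: "0 < Z" using partition_pos[OF assms(1)] by (simp add: Z_def)
  have g: "g \<in> states n" using gibbs_in_states[OF assms(1)] by (simp add: g_def)
  have ln_g: "ln (g i) = t * a i - ln Z" if "i \<in> {1..n}" for i
  proof -
    have "g i = exp (t * a i) / Z" using that by (simp add: g_def gibbs_def Z_def)
    then show ?thesis using Z by (simp add: ln_div)
  qed
  have cross: "(\<Sum>i=1..n. z i * ln (g i)) = t * expect n a z - ln Z" if "z \<in> states n" for z
  proof -
    have "(\<Sum>i=1..n. z i * ln (g i)) = (\<Sum>i=1..n. t * (a i * z i) - z i * ln Z)"
      by (intro sum.cong) (simp_all add: ln_g algebra_simps)
    then show ?thesis using states_sum[OF that]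
      by (simp add: sum_subtractf expect_def flip: sum_distrib_left sum_distrib_right)
  qed
  have "(\<Sum>i=1..n. x i * ln (g i)) = (\<Sum>i=1..n. g i * ln (g i))"
    using cross[OF assms(2)] cross[OF g] assms(3) by (simp add: g_def)
  then have gap: "(\<Sum>i=1..n. D i) = entropy n g - entropy n x"
    using states_sum[OF assms(2)] states_sum[OF g]
    by (simp add: D_def entropy_def sum_subtractf sum.distrib right_diff_distrib)
  have D: "0 \<le> D i" "D i = 0 \<Longrightarrow> x i = g i" if "i \<in> {1..n}" for i
    using divergence_term_nonneg[of "x i" "g i"] states_nonneg[OF assms(2), of i]
      gibbs_pos[OF that, of a t] by (auto simp: D_def g_def)
  show "entropy n x \<le> entropy n (gibbs n a t)"
    using gap sum_nonneg[of "{1..n}" D] D(1) by (simp add: g_def)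
  assume "entropy n x = entropy n (gibbs n a t)"
  then have "(\<Sum>i=1..n. D i) = 0" using gap by (simp add: g_def)
  then have "\<forall>i\<in>{1..n}. D i = 0" using D(1) by (subst (asm) sum_nonneg_eq_0_iff) auto
  show "x = gibbs n a t"
  proof
    fix i show "x i = gibbs n a t i"
      using \<open>\<forall>i\<in>{1..n}. D i = 0\<close> D(2)[of i] assms(2) g
      by (cases "i \<in> {1..n}") (auto simp: g_def states_def)
  qed
qed

lemma max_entropy_state_iff:
  assumes "1 \<le> n" "mean_gap n a E t = 0"
  shows "max_entropy_state n a E y \<longleftrightarrow> y = gibbs n a t"
proof -
  have g: "gibbs n a t \<in> states n" "expect n a (gibbs n a t) = E"
    using gibbs_in_states[OF assms(1)] assms(2) by (auto simp: mean_gap_eq)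
  have le: "entropy n x \<le> entropy n (gibbs n a t)" if "x \<in> states n" "expect n a x = E" for x
    using entropy_le_gibbs(1)[OF assms(1) that(1)] that(2) g(2) by simp
  have sup: "(SUP x\<in>{x \<in> states n. expect n a x = E}. entropy n x) = entropy n (gibbs n a t)"
    using g le by (intro cSup_eq_maximum) auto
  show ?thesis
    unfolding max_entropy_state_def sup
    using entropy_le_gibbs(2)[OF assms(1), of y a t] g by auto
qed

lemma expect_bounds:
  assumes "x \<in> states n" "\<And>i. i \<in> {1..n} \<Longrightarrow> lo \<le> a i \<and> a i \<le> hi"
  shows "lo \<le> expect n a x" "expect n a x \<le> hi"
proof -
  have "(\<Sum>i=1..n. lo * x i) \<le> expect n a x" "expect n a x \<le> (\<Sum>i=1..n. hi * x i)"
    unfolding expect_def using assms states_nonneg[OF assms(1)]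
    by (auto intro!: sum_mono mult_right_mono)
  then show "lo \<le> expect n a x" "expect n a x \<le> hi"
    using states_sum[OF assms(1)] by (simp_all flip: sum_distrib_left)
qed

text \<open>
  The derivative of the mean is the variance of \<open>a\<close> under the Gibbs distribution, which is at most the mean
  square deviation of \<open>a\<close> from the constant \<open>lo\<close>, hence at most \<open>(hi - lo)\<^sup>2\<close>. In terms of the
  unnormalized moments \<open>Z\<close>, \<open>M\<close>, \<open>Q\<close> of orders 0, 1, 2 the variance is \<open>Q / Z - (M / Z)\<^sup>2\<close>.
\<close>

lemma mean_gap_has_derivative:
  assumes "1 \<le> n" "\<And>i. i \<in> {1..n} \<Longrightarrow> lo \<le> a i \<and> a i \<le> hi"
  obtains v where "(mean_gap n a E has_real_derivative v) (at t)" "v \<le> (hi - lo)\<^sup>2"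
proof -
  define Z where "Z = (\<Sum>i=1..n. exp (t * a i))"
  define M where "M = (\<Sum>i=1..n. a i * exp (t * a i))"
  define Q where "Q = (\<Sum>i=1..n. (a i)\<^sup>2 * exp (t * a i))"
  have Z: "0 < Z" unfolding Z_def by (rule partition_pos[OF assms(1)])
  have dZ: "((\<lambda>t. \<Sum>i=1..n. exp (t * a i)) has_real_derivative M) (at t)"
    unfolding M_def by (auto intro!: derivative_eq_intros sum.cong simp: mult.commute)
  have dM: "((\<lambda>t. \<Sum>i=1..n. a i * exp (t * a i)) has_real_derivative Q) (at t)"
    unfolding Q_def by (auto intro!: derivative_eq_intros sum.cong simp: power2_eq_square)
  have "mean_gap n a E = (\<lambda>t. (\<Sum>i=1..n. a i * exp (t * a i)) / (\<Sum>i=1..n. exp (t * a i)) - E)"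
    by (rule ext) (simp add: mean_gap_def)
  moreover have "((\<lambda>t. (\<Sum>i=1..n. a i * exp (t * a i)) / (\<Sum>i=1..n. exp (t * a i)) - E)
      has_real_derivative ((Q * Z - M * M) / (Z * Z))) (at t)"
    using DERIV_diff[OF DERIV_divide[OF dM dZ] DERIV_const[of E]] Z
    by (simp add: Z_def M_def)
  ultimately have deriv: "(mean_gap n a E has_real_derivative ((Q * Z - M * M) / (Z * Z))) (at t)"
    by simp
  have "Q - 2 * lo * M + lo\<^sup>2 * Z = (\<Sum>i=1..n. (a i - lo)\<^sup>2 * exp (t * a i))"
    unfolding Q_def M_def Z_def
    by (simp add: power2_diff sum_distrib_left algebra_simps sum.distrib sum_subtractf)
  also have "\<dots> \<le> (\<Sum>i=1..n. (hi - lo)\<^sup>2 * exp (t * a i))"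
    using assms(2) by (intro sum_mono mult_right_mono power_mono) auto
  also have "\<dots> = (hi - lo)\<^sup>2 * Z" by (simp add: Z_def sum_distrib_left)
  finally have "(Q - 2 * lo * M + lo\<^sup>2 * Z) * Z \<le> (hi - lo)\<^sup>2 * Z * Z"
    using Z by (intro mult_right_mono) auto
  \<comment> \<open>The variance is the mean square deviation from \<open>lo\<close> minus the squared deviation of the mean.\<close>
  moreover have "Q * Z - M * M = (Q - 2 * lo * M + lo\<^sup>2 * Z) * Z - (M - lo * Z)\<^sup>2"
    by (simp add: power2_eq_square algebra_simps)
  moreover have "0 \<le> (M - lo * Z)\<^sup>2" by simp
  ultimately have "Q * Z - M * M \<le> (hi - lo)\<^sup>2 * Z * Z" by linarith
  then have "Q * Z - M * M \<le> (hi - lo)\<^sup>2 * (Z * Z)" by (simp only: mult.assoc)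
  then have "(Q * Z - M * M) / (Z * Z) \<le> (hi - lo)\<^sup>2" using Z by (simp add: divide_le_eq)
  then show ?thesis using deriv that by blast
qed

lemma isCont_mean_gap: "1 \<le> n \<Longrightarrow> isCont (mean_gap n a E) t"
  using partition_pos[of n t a] unfolding mean_gap_def
  by (intro continuous_intros) auto

lemma isCont_gibbs: "1 \<le> n \<Longrightarrow> isCont (\<lambda>t. gibbs n a t i) t"
  using partition_pos[of n t a] unfolding gibbs_def
  by (cases "i \<in> {1..n}") (auto intro!: continuous_intros)

text \<open>
  The denominator in \<open>I_f\<close> is exactly the bound for the derivative of the mean, so that the
  derivative of \<open>I_f\<close> is nonnegative.
\<close>

lemma I_f_mono:
  assumes "1 \<le> n" "\<And>i. i \<in> {1..n} \<Longrightarrow> a 1 \<le> a i \<and> a i \<le> a n" "a 1 < a n" "s \<le> t"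
  shows "I_f n a E s \<le> I_f n a E t"
proof (rule DERIV_nonneg_imp_nondecreasing[OF assms(4)])
  fix x
  obtain v where v: "(mean_gap n a E has_real_derivative v) (at x)" "v \<le> (a n - a 1)\<^sup>2"
    using mean_gap_has_derivative[OF assms(1,2)] .
  have "(I_f n a E has_real_derivative 1 - v / (a n - a 1)\<^sup>2) (at x)"
    using DERIV_diff[OF DERIV_ident DERIV_cdivide[OF v(1), of "(a n - a 1)\<^sup>2"]]
    by (simp add: I_f_def[abs_def])
  moreover have "0 \<le> 1 - v / (a n - a 1)\<^sup>2" using v(2) assms(3) by (simp add: divide_le_eq)
  ultimately show "\<exists>y. (I_f n a E has_real_derivative y) (at x) \<and> 0 \<le> y" by blast
qed

section \<open>The dynamics on Gibbs states\<close>

locale mean_energy =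
  fixes n :: nat and a :: "nat \<Rightarrow> real" and E :: real
  assumes two_le: "2 \<le> n"
    and a_Suc: "\<And>i. 1 \<le> i \<Longrightarrow> i < n \<Longrightarrow> a i < a (i + 1)"
    and above: "a 1 < E" and below: "E < a n"
begin

lemma one_le: "1 \<le> n"
  using two_le by simp

lemma a_less:
  assumes "1 \<le> i" "i < j" "j \<le> n"
  shows "a i < a j"
  using assms(2,3)
proof (induction j)
  case (Suc j)
  have "a j < a (Suc j)" using a_Suc[of j] Suc.prems assms(1) by simp
  moreover have "a i \<le> a j" using Suc by (cases "i = j") auto
  ultimately show ?case by simp
qed simp

lemma a_le: "1 \<le> i \<Longrightarrow> i \<le> j \<Longrightarrow> j \<le> n \<Longrightarrow> a i \<le> a j"
  using a_less[of i j] by (cases "i = j") auto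

lemma range_a: "i \<in> {1..n} \<Longrightarrow> a 1 \<le> a i \<and> a i \<le> a n"
  by (auto intro: a_le)

lemma ends_less: "a 1 < a n"
  using above below by simp

lemma mono_I_f: "s \<le> t \<Longrightarrow> I_f n a E s \<le> I_f n a E t"
  by (rule I_f_mono[OF one_le range_a ends_less])

text \<open>
  The sign of \<open>I_f n a E 0\<close> decides whether \<open>a n\<close> or \<open>a 1\<close> is the extreme towards which \<open>phi\<close>
  pushes. The two cases are mirror images; they are treated together by naming the largest and
  second largest entry of the Gibbs states on the relevant side of 0, and by expressing that \<open>t\<close> lies on
  this side as \<open>0 \<le> t * slope\<close>. The denominator in \<open>ell\<close> is \<open>slope\<close> in either case.
\<close>

definition top_index :: nat where
  "top_index = (if 0 < I_f n a E 0 then n else 1)"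

definition next_index :: nat where
  "next_index = (if 0 < I_f n a E 0 then n - 1 else 2)"

definition slope :: real where
  "slope = a top_index - a next_index"

lemma top_index_mem: "top_index \<in> {1..n}"
  using two_le by (simp add: top_index_def)

lemma next_index_mem: "next_index \<in> {1..n} - {top_index}"
  using two_le by (auto simp: top_index_def next_index_def)

lemma slope_sign: "if 0 < I_f n a E 0 then 0 < slope else slope < 0"
  using two_le a_less[of "n - 1" n] a_less[of 1 2]
  by (auto simp: slope_def top_index_def next_index_def)

lemma slope_nonzero: "slope \<noteq> 0"
  using slope_sign by (auto split: if_splits)

lemma top_index_extremal:
  assumes "i \<in> {1..n}" "i \<noteq> top_index"
  shows "0 < (a top_index - a i) * slope"
proof (cases "0 < I_f n a E 0")
  case True
  then have "a i < a n" using assms a_less[of i n] by (auto simp: top_index_def)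
  then show ?thesis using True slope_sign by (simp add: top_index_def)
next
  case False
  then have "a 1 < a i" using assms a_less[of 1 i] by (auto simp: top_index_def)
  then show ?thesis using False slope_sign by (simp add: top_index_def zero_less_mult_iff)
qed

lemma next_index_extremal:
  assumes "i \<in> {1..n}" "i \<noteq> top_index"
  shows "0 \<le> (a next_index - a i) * slope"
proof (cases "0 < I_f n a E 0")
  case True
  then have "a i \<le> a (n - 1)" using assms a_le[of i "n - 1"] by (auto simp: top_index_def)
  then show ?thesis using True slope_sign by (simp add: next_index_def)
next
  case False
  then have "a 2 \<le> a i" using assms a_le[of 2 i] by (auto simp: top_index_def)
  then show ?thesis using False slope_sign by (simp add: next_index_def zero_le_mult_iff)
qed

lemma target_towards_top: "0 < (a top_index - E) * slope"
  using above below slope_sign by (simp add: top_index_def zero_less_mult_iff split: if_splits)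

lemma I_f_zero_slope: "0 \<le> I_f n a E 0 * slope"
  using slope_sign by (auto simp: zero_le_mult_iff split: if_splits)

lemma mean_gap_zero_slope: "mean_gap n a E 0 * slope \<le> 0"
proof -
  have "mean_gap n a E 0 = - (a n - a 1)\<^sup>2 * I_f n a E 0"
    using ends_less by (simp add: I_f_def)
  then have "mean_gap n a E 0 * slope = - ((a n - a 1)\<^sup>2 * (I_f n a E 0 * slope))" by simp
  then show ?thesis using I_f_zero_slope by simp
qed

text \<open>
  By monotonicity, \<open>I_f\<close> maps the relevant half-line, of which \<open>I_f n a E 0\<close> is a member, to itself.
\<close>

lemma I_f_towards_top:
  assumes "0 \<le> t * slope"
  shows "0 \<le> I_f n a E t * slope"
proof (cases "0 < I_f n a E 0")
  case True
  then have "0 \<le> t" using assms slope_sign by (simp add: zero_le_mult_iff)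
  then show ?thesis using True mono_I_f[of 0 t] slope_sign by simp
next
  case False
  then have "t \<le> 0" using assms slope_sign by (simp add: zero_le_mult_iff)
  then show ?thesis using False mono_I_f[of t 0] slope_sign by (simp add: zero_le_mult_iff)
qed

lemma gibbs_I_f_mono:
  assumes "0 \<le> u" "u \<le> v"
  shows "pairwise_le n (gibbs n a (I_f n a E (u * slope))) (gibbs n a (I_f n a E (v * slope)))"
proof (rule gibbs_mono, cases "0 < I_f n a E 0")
  case True
  then have "0 \<le> u * slope" "u * slope \<le> v * slope"
    using assms slope_sign by (auto intro: mult_right_mono)
  then show "0 \<le> I_f n a E (u * slope) \<and> I_f n a E (u * slope) \<le> I_f n a E (v * slope) \<or>
      I_f n a E (v * slope) \<le> I_f n a E (u * slope) \<and> I_f n a E (u * slope) \<le> 0"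
    using mono_I_f[of 0 "u * slope"] mono_I_f[of "u * slope" "v * slope"] True by auto
next
  case False
  then have "u * slope \<le> 0" "v * slope \<le> u * slope"
    using assms slope_sign by (auto intro: mult_right_mono_neg simp: mult_le_0_iff)
  then show "0 \<le> I_f n a E (u * slope) \<and> I_f n a E (u * slope) \<le> I_f n a E (v * slope) \<or>
      I_f n a E (v * slope) \<le> I_f n a E (u * slope) \<and> I_f n a E (u * slope) \<le> 0"
    using mono_I_f[of "u * slope" 0] mono_I_f[of "v * slope" "u * slope"] False by auto
qed

lemma gibbs_ratio:
  assumes "i \<in> {1..n}"
  shows "gibbs n a t i / gibbs n a t top_index = exp (- (t * (a top_index - a i)))"
  using assms top_index_mem partition_pos[OF one_le, of t a]
  by (simp add: gibbs_def exp_diff[symmetric] right_diff_distrib)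

lemma sign_towards_top:
  assumes "0 \<le> t * slope" "0 \<le> r * slope"
  shows "0 \<le> t * r"
  using assms slope_nonzero by (auto simp: zero_le_mult_iff)

lemma top_index_peak:
  assumes "0 \<le> t * slope"
  shows "top_index \<in> peaks n (gibbs n a t)"
proof -
  have "gibbs n a t i \<le> gibbs n a t top_index" if i: "i \<in> {1..n}" for i
  proof (cases "i = top_index")
    case False
    then have "0 \<le> t * (a top_index - a i)"
      using sign_towards_top[OF assms] top_index_extremal[OF i] by simp
    then have "gibbs n a t i / gibbs n a t top_index \<le> 1" using gibbs_ratio[OF i] by simp
    then show ?thesis using gibbs_pos[OF top_index_mem, of a t] by (simp add: divide_le_eq)
  qed simp
  then show ?thesis using top_index_mem by (simp add: peaks_def)
qed

text \<open>
  This recovers the parameter \<open>t\<close> of a Gibbs state on the relevant side of 0 from its two largest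
  entries, and so identifies \<open>ell\<close> as the inverse of the parametrization.
\<close>

lemma gap_ratio_gibbs:
  assumes "0 \<le> t * slope"
  shows "gap_ratio n (gibbs n a t) = exp (- (t * slope))"
proof -
  define J where "J = {1..n} - {top_index}"
  have "gap_ratio n (gibbs n a t) = Max ((\<lambda>i. gibbs n a t i / gibbs n a t top_index) ` J)"
    unfolding J_def by (rule gap_ratio_peak[OF two_le gibbs_in_states[OF one_le] top_index_peak[OF assms]])
  also have "\<dots> = exp (- (t * slope))"
  proof (rule Max_eqI)
    show "exp (- (t * slope)) \<in> (\<lambda>i. gibbs n a t i / gibbs n a t top_index) ` J"
    proof (rule image_eqI)
      show "next_index \<in> J" using next_index_mem by (simp add: J_def)
      show "exp (- (t * slope)) = gibbs n a t next_index / gibbs n a t top_index"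
        using next_index_mem by (simp add: gibbs_ratio slope_def)
    qed
    fix q assume "q \<in> (\<lambda>i. gibbs n a t i / gibbs n a t top_index) ` J"
    then obtain i where i: "i \<in> {1..n}" "i \<noteq> top_index"
      and q: "q = gibbs n a t i / gibbs n a t top_index" unfolding J_def by blast
    have "0 \<le> t * (a next_index - a i)" using sign_towards_top[OF assms] next_index_extremal[OF i] by simp
    then show "q \<le> exp (- (t * slope))"
      unfolding q gibbs_ratio[OF i(1)] by (simp add: slope_def algebra_simps)
  qed (simp add: J_def)
  finally show ?thesis .
qed

lemma gibbs_le_pure:
  assumes "0 \<le> t * slope"
  shows "pairwise_le n (gibbs n a t) (pure_state top_index)"
proof -
  have "gibbs n a t i \<le> gibbs n a t top_index" if "i \<in> {1..n}" for i
    using top_index_peak[OF assms] that by (auto simp: peaks_def)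
  moreover have "0 \<le> gibbs n a t i" for i using states_nonneg[OF gibbs_in_states[OF one_le]] .
  ultimately have "ratio_le (gibbs n a t) (pure_state top_index) i j \<or>
      ratio_le (gibbs n a t) (pure_state top_index) j i" if "i \<in> {1..n}" "j \<in> {1..n}" for i j
    using that by (cases "i = top_index"; cases "j = top_index")
      (auto simp: ratio_le_def pure_state_def)
  then show ?thesis by (simp add: pairwise_le_def)
qed

text \<open>
  Relative to the top entry every other entry decays exponentially, at a rate proportional to its
  energy gap. The top entry is then determined by normalization.
\<close>

lemma gibbs_tendsto_pure:
  assumes "filterlim (\<lambda>m. t m * slope) at_top F"
  shows "((\<lambda>m. gibbs n a (t m) i) \<longlongrightarrow> pure_state top_index i) F"
proof -
  have others: "((\<lambda>m. gibbs n a (t m) i) \<longlongrightarrow> 0) F" if i: "i \<in> {1..n}" "i \<noteq> top_index" for i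
  proof -
    define c where "c = (a top_index - a i) * slope / slope\<^sup>2"
    have c: "0 < c" using top_index_extremal[OF i] slope_nonzero by (simp add: c_def)
    have rate: "t m * (a top_index - a i) = c * (t m * slope)" for m
      using slope_nonzero by (simp add: c_def power2_eq_square)
    have "filterlim (\<lambda>m. c * (t m * slope)) at_top F"
      using filterlim_tendsto_pos_mult_at_top[OF tendsto_const c assms] .
    then have "filterlim (\<lambda>m. - (c * (t m * slope))) at_bot F"
      by (simp add: filterlim_uminus_at_top)
    then have lim: "((\<lambda>m. exp (- (c * (t m * slope)))) \<longlongrightarrow> 0) F"
      by (rule filterlim_compose[OF exp_at_bot])
    have "gibbs n a (t m) i \<le> exp (- (c * (t m * slope)))" for m
    proof -
      have "gibbs n a (t m) top_index \<le> 1"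
        using gibbs_in_states[OF one_le] top_index_mem by (simp add: states_def)
      then have "gibbs n a (t m) i / 1 \<le> gibbs n a (t m) i / gibbs n a (t m) top_index"
        using gibbs_pos[OF i(1), of a "t m"] gibbs_pos[OF top_index_mem, of a "t m"]
        by (intro divide_left_mono) auto
      then show ?thesis unfolding gibbs_ratio[OF i(1)] rate by simp
    qed
    then show ?thesis
      using gibbs_pos[OF i(1)]
      by (intro tendsto_sandwich[OF _ _ tendsto_const lim]) (auto intro!: always_eventually less_imp_le)
  qed
  consider "i \<notin> {1..n}" | "i \<in> {1..n}" "i \<noteq> top_index" | "i = top_index" by blast
  then show ?thesis
  proof cases
    case 1
    then have "gibbs n a t' i = 0" "pure_state top_index i = 0" for t'
      using top_index_mem by (auto simp: gibbs_def pure_state_def)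
    then show ?thesis by simp
  next
    case 2
    then show ?thesis using others by (simp add: pure_state_def)
  next
    case 3
    have "gibbs n a t' top_index = 1 - (\<Sum>i\<in>{1..n} - {top_index}. gibbs n a t' i)" for t'
      using sum.remove[of "{1..n}" top_index "gibbs n a t'"] top_index_mem
        states_sum[OF gibbs_in_states[OF one_le, of a t']] by simp
    moreover have "((\<lambda>m. 1 - (\<Sum>i\<in>{1..n} - {top_index}. gibbs n a (t m) i)) \<longlongrightarrow>
        1 - (\<Sum>i\<in>{1..n} - {top_index}. 0)) F"
      using others by (intro tendsto_diff tendsto_const tendsto_sum) auto
    ultimately show ?thesis using 3 by (simp add: pure_state_def)
  qed
qed

text \<open>
  On states, \<open>phi\<close> depends only on the gap ratio, see the next lemma. The special value at 0 is the
  continuous extension, see the convergence lemma below.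
\<close>

definition gibbs_step :: "real \<Rightarrow> nat \<Rightarrow> real" where
  "gibbs_step q = (if q = 0 then pure_state top_index else gibbs n a (I_f n a E (- ln q / slope)))"

lemma phi_eq_gibbs_step:
  assumes "x \<in> states n"
  shows "phi n a E x = gibbs_step (gap_ratio n x)"
proof -
  have ln: "ln (sort_desc n x 1 / sort_desc n x 2) = - ln (gap_ratio n x)"
    unfolding gap_ratio_def by (simp flip: ln_inverse)
  show ?thesis
    using gap_ratio_bounds(3)[OF two_le assms] unfolding phi_def ell_def gibbs_step_def ln
    by (auto simp: top_index_def slope_def next_index_def)
qed

lemma gibbs_step_in_states: "gibbs_step q \<in> states n"
  using gibbs_in_states[OF one_le] pure_state_in_states[OF top_index_mem] by (simp add: gibbs_step_def)

lemma exponent_towards_top: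
  assumes "0 < q" "q \<le> 1"
  shows "0 \<le> - ln q / slope * slope"
  using assms slope_nonzero by simp

lemma gibbs_step_antimono:
  assumes "0 \<le> q" "q \<le> q'" "q' \<le> 1"
  shows "pairwise_le n (gibbs_step q') (gibbs_step q)"
proof -
  \<comment> \<open>Measuring the parameter in units of \<open>slope\<close> turns both cases into a nonnegative quantity.\<close>
  have rescale: "- ln r / slope = (- ln r / slope\<^sup>2) * slope" for r
    using slope_nonzero by (simp add: power2_eq_square)
  consider "q' = 0" | "q = 0" "0 < q'" | "0 < q" "0 < q'" using assms by linarith
  then show ?thesis
  proof cases
    case 1
    then show ?thesis using assms by (simp add: pairwise_le_refl)
  next
    case 2
    then show ?thesis
      using gibbs_le_pure I_f_towards_top exponent_towards_top assms by (simp add: gibbs_step_def)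
  next
    case 3
    have "0 \<le> - ln q' / slope\<^sup>2" "- ln q' / slope\<^sup>2 \<le> - ln q / slope\<^sup>2"
      using 3 assms by (auto intro!: divide_right_mono simp: divide_nonpos_nonneg)
    then have "pairwise_le n (gibbs n a (I_f n a E ((- ln q' / slope\<^sup>2) * slope)))
        (gibbs n a (I_f n a E ((- ln q / slope\<^sup>2) * slope)))"
      by (rule gibbs_I_f_mono)
    then show ?thesis using 3 unfolding gibbs_step_def rescale by simp
  qed
qed

text \<open>
  Only the limit \<open>q' = 0\<close> needs an argument: there the parameter diverges towards the side of \<open>slope\<close>, and
  so does its image under \<open>I_f\<close>, because \<open>mean_gap\<close> is bounded.
\<close>

lemma gibbs_step_tendsto:
  assumes "\<And>m. 0 < q m" "q \<longlonglongrightarrow> q'" "0 \<le> q'"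
  shows "(\<lambda>m. gibbs_step (q m) i) \<longlonglongrightarrow> gibbs_step q' i"
proof -
  have gibbs_step: "gibbs_step (q m) i = gibbs n a (I_f n a E (- ln (q m) / slope)) i" for m
    using assms(1)[of m] by (simp add: gibbs_step_def)
  have cont: "isCont (I_f n a E) t" for t
    unfolding I_f_def[abs_def] using isCont_mean_gap[OF one_le] ends_less
    by (intro continuous_intros) auto
  show ?thesis
  proof (cases "q' = 0")
    case False
    then have "(\<lambda>m. - ln (q m) / slope) \<longlonglongrightarrow> - ln q' / slope"
      using assms slope_nonzero by (intro tendsto_intros) auto
    then have "(\<lambda>m. I_f n a E (- ln (q m) / slope)) \<longlonglongrightarrow> I_f n a E (- ln q' / slope)"
      by (rule isCont_tendsto_compose[OF cont])
    then have "(\<lambda>m. gibbs n a (I_f n a E (- ln (q m) / slope)) i)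
        \<longlonglongrightarrow> gibbs n a (I_f n a E (- ln q' / slope)) i"
      by (rule isCont_tendsto_compose[OF isCont_gibbs[OF one_le]])
    then show ?thesis unfolding gibbs_step using False by (simp add: gibbs_step_def)
  next
    case True
    define C where "C = (\<bar>a 1\<bar> + \<bar>a n\<bar> + \<bar>E\<bar>) * \<bar>slope\<bar> / (a n - a 1)\<^sup>2"
    have bound: "t * slope - C \<le> I_f n a E t * slope" for t
    proof -
      have "a 1 \<le> expect n a (gibbs n a t)" "expect n a (gibbs n a t) \<le> a n"
        using expect_bounds[OF gibbs_in_states[OF one_le] range_a] by auto
      then have "\<bar>mean_gap n a E t\<bar> \<le> \<bar>a 1\<bar> + \<bar>a n\<bar> + \<bar>E\<bar>"
        unfolding mean_gap_eq by linarith
      then have "\<bar>mean_gap n a E t * slope / (a n - a 1)\<^sup>2\<bar> \<le> C"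
        by (simp add: C_def abs_mult divide_right_mono mult_right_mono)
      then have "mean_gap n a E t * slope / (a n - a 1)\<^sup>2 \<le> C" by (rule abs_le_D1)
      then show ?thesis by (simp add: I_f_def left_diff_distrib)
    qed
    have "filterlim q (at_right 0) sequentially"
      using assms(1,2) True by (intro tendsto_imp_filterlim_at_right) auto
    then have "filterlim (\<lambda>m. ln (q m)) at_bot sequentially"
      by (rule filterlim_compose[OF ln_at_0])
    then have "filterlim (\<lambda>m. - ln (q m)) at_top sequentially"
      by (simp add: filterlim_uminus_at_top)
    then have "filterlim (\<lambda>m. - C + - ln (q m)) at_top sequentially"
      by (rule filterlim_tendsto_add_at_top[OF tendsto_const])
    then have "filterlim (\<lambda>m. I_f n a E (- ln (q m) / slope) * slope) at_top sequentially"
    proof (rule filterlim_at_top_mono, intro always_eventually allI)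
      show "- C + - ln (q m) \<le> I_f n a E (- ln (q m) / slope) * slope" for m
        using bound[of "- ln (q m) / slope"] slope_nonzero by simp
    qed
    then show ?thesis unfolding gibbs_step using True gibbs_tendsto_pure by (simp add: gibbs_step_def)
  qed
qed

lemma gibbs_step_gibbs:
  assumes "0 \<le> t * slope"
  shows "gibbs_step (gap_ratio n (gibbs n a t)) = gibbs n a (I_f n a E t)"
  using gap_ratio_gibbs[OF assms] slope_nonzero by (simp add: gibbs_step_def)

lemma phi_mono:
  assumes "x \<in> states n" "y \<in> states n" "pairwise_le n x y"
  shows "pairwise_le n (phi n a E x) (phi n a E y)"
  unfolding phi_eq_gibbs_step[OF assms(1)] phi_eq_gibbs_step[OF assms(2)]
  using gap_ratio_bounds[OF two_le] gap_ratio_antimono[OF two_le assms(3,1,2)] assms(1,2)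
  by (intro gibbs_step_antimono) auto

lemma phi_in_states: "x \<in> states n \<Longrightarrow> phi n a E x \<in> states n"
  by (simp add: phi_eq_gibbs_step gibbs_step_in_states)

text \<open>
  If some element of \<open>S\<close> is pure, so is \<open>s\<close>, and \<open>phi\<close> attains its value at \<open>s\<close> on \<open>S\<close>. Otherwise \<open>s\<close> is
  a limit of elements of \<open>S\<close> with positive gap ratio, along which \<open>phi\<close> is continuous, and an upper
  bound of the images is inherited by the limit.
\<close>

lemma phi_lub:
  assumes S: "directed (bayes_order n) S" and s: "s \<in> states n"
    and lim: "\<And>x. x \<in> S \<Longrightarrow>
      \<exists>y. (\<forall>m. y m \<in> S \<and> pairwise_le n x (y m)) \<and> (\<forall>i. (\<lambda>m. y m i) \<longlonglongrightarrow> s i)"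
  shows "is_lub (bayes_order n) (phi n a E s) (phi n a E ` S)"
proof -
  note SD = directed_bayesD[OF two_le S]
  have "is_lub (bayes_order n) s S" by (rule is_lub_limit[OF two_le S s lim])
  then have upper: "pairwise_le n x s" if "x \<in> S" for x
    using that SD(1) s by (auto simp: least_def Upper_def bayes_order_le[OF two_le] subset_iff)
  have least: "pairwise_le n (phi n a E s) u"
    if u: "\<And>x. x \<in> S \<Longrightarrow> pairwise_le n (phi n a E x) u" for u
  proof (cases "\<exists>x\<in>S. gap_ratio n x = 0")
    case True
    then obtain x where x: "x \<in> S" "gap_ratio n x = 0" by blast
    then have "x \<in> states n" using SD(1) by blast
    then have "gap_ratio n s = 0"
      using gap_ratio_antimono[OF two_le upper[OF x(1)]] gap_ratio_bounds(1)[OF two_le s] s x(2)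
      by simp
    then have "phi n a E s = phi n a E x" using \<open>x \<in> states n\<close> s x(2) by (simp add: phi_eq_gibbs_step)
    then show ?thesis using u[OF x(1)] by simp
  next
    case False
    obtain x where "x \<in> S" using SD(2) by blast
    then obtain y where y: "\<And>m. y m \<in> S" "\<And>i. (\<lambda>m. y m i) \<longlonglongrightarrow> s i" using lim by blast
    have ys: "y m \<in> states n" for m using y(1) SD(1) by blast
    have pos: "0 < gap_ratio n (y m)" for m
      using False y(1)[of m] gap_ratio_bounds(1)[OF two_le ys, of m] by force
    have "(\<lambda>m. gap_ratio n (y m)) \<longlonglongrightarrow> gap_ratio n s"
      using gap_ratio_tendsto[OF two_le ys s upper y(2)] y(1) by blast
    then have "(\<lambda>m. phi n a E (y m) i) \<longlonglongrightarrow> phi n a E s i" for i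
      unfolding phi_eq_gibbs_step[OF s] phi_eq_gibbs_step[OF ys]
      by (intro gibbs_step_tendsto pos gap_ratio_bounds(1)[OF two_le s])
    then show ?thesis using pairwise_le_tendsto[of n "\<lambda>m. phi n a E (y m)" "\<lambda>_. u"] u y(1) by simp
  qed
  show ?thesis
    unfolding least_def Upper_def
    using SD(1) s phi_in_states phi_mono upper least
    by (auto simp: bayes_order_le[OF two_le] subset_iff)
qed

lemma scott_continuous_phi: "scott_continuous (bayes_order n) (bayes_order n) (phi n a E)"
proof -
  have po: "partial_order (bayes_order n)" by (rule partial_order_bayes[OF two_le])
  have "isotone (bayes_order n) (bayes_order n) (phi n a E)"
    using partial_order.axioms(1)[OF po] phi_mono phi_in_states
    by (auto simp: isotone_def bayes_order_le[OF two_le])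
  moreover have "phi n a E (\<Squnion>\<^bsub>bayes_order n\<^esub>S) = \<Squnion>\<^bsub>bayes_order n\<^esub>(phi n a E ` S)"
    if S: "directed (bayes_order n) S" for S
  proof -
    obtain s where s: "s \<in> states n" and lim: "\<And>x. x \<in> S \<Longrightarrow>
      \<exists>y. (\<forall>m. y m \<in> S \<and> pairwise_le n x (y m)) \<and> (\<forall>i. (\<lambda>m. y m i) \<longlonglongrightarrow> s i)"
      using directed_limit[OF two_le S] by blast
    show ?thesis
      using sup_eq_lub[OF po is_lub_limit[OF two_le S s lim]] sup_eq_lub[OF po phi_lub[OF S s lim]]
      by simp
  qed
  ultimately show ?thesis
    using dcpo_bayes[OF two_le] phi_in_states by (auto simp: scott_continuous_def)
qed

text \<open>
  The mean tends to the extreme value \<open>a top_index\<close> on the relevant side, beyond \<open>E\<close>, while at 0 it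
  has not passed \<open>E\<close>; the choice of side was made for this. The intermediate value theorem applies.
\<close>

lemma mean_gap_root:
  obtains t where "mean_gap n a E t = 0" "0 \<le> t * slope"
proof -
  define h where "h u = mean_gap n a E (u * slope) * slope" for u
  have "filterlim (\<lambda>u. slope\<^sup>2 * u) at_top at_top"
    using slope_nonzero by (intro filterlim_tendsto_pos_mult_at_top[OF tendsto_const _ filterlim_ident]) simp
  then have "filterlim (\<lambda>u. (u * slope) * slope) at_top at_top"
    by (simp add: power2_eq_square mult_ac)
  then have "((\<lambda>u. \<Sum>i=1..n. a i * gibbs n a (u * slope) i) \<longlongrightarrow>
      (\<Sum>i=1..n. a i * pure_state top_index i)) at_top"
    by (intro tendsto_intros gibbs_tendsto_pure)
  also have "(\<Sum>i=1..n. a i * pure_state top_index i) = a top_index"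
    using top_index_mem by (simp add: pure_state_def if_distrib cong: if_cong)
  finally have "(h \<longlongrightarrow> (a top_index - E) * slope) at_top"
    unfolding h_def mean_gap_eq expect_def by (intro tendsto_intros)
  then have "\<forall>\<^sub>F u in at_top. 0 < h u" by (rule order_tendstoD(1)[OF _ target_towards_top])
  then have "\<forall>\<^sub>F u in at_top. 0 < h u \<and> 0 \<le> u"
    using eventually_ge_at_top[of 0] by eventually_elim simp
  then obtain u1 where u1: "0 < h u1" "0 \<le> u1"
    using eventually_happens trivial_limit_at_top_linorder by blast
  have "isCont h u" for u
    unfolding h_def by (intro continuous_intros isCont_o2[OF _ isCont_mean_gap[OF one_le]])
  then obtain u where "0 \<le> u" "h u = 0"
    using IVT[of h 0 0 u1] u1 mean_gap_zero_slope by (auto simp: h_def)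
  then show ?thesis
    using that[of "u * slope"] slope_nonzero by (simp add: h_def mult.assoc)
qed

text \<open>
  A fixed point that is not pure is a Gibbs state whose parameter is a fixed point of \<open>I_f\<close>, that is, a
  zero of \<open>mean_gap\<close>. By uniqueness of the maximum entropy state there is only one such state.
  The pure state at the top index is also a fixed point, but it lies above all Gibbs states on its side.
\<close>

lemma least_fixed_point:
  assumes "mean_gap n a E t = 0" "0 \<le> t * slope"
  shows "least (bayes_order n) (gibbs n a t) (fps (bayes_order n) (phi n a E))"
proof -
  have fps: "fps (bayes_order n) (phi n a E) = {x \<in> states n. phi n a E x = x}"
    by (simp add: fps_def bayes_order_def)
  have g: "gibbs n a t \<in> states n" by (rule gibbs_in_states[OF one_le])
  have fixed: "phi n a E (gibbs n a t) = gibbs n a t"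
    using gibbs_step_gibbs[OF assms(2)] assms(1) by (simp add: phi_eq_gibbs_step[OF g] I_f_def)
  have "pairwise_le n (gibbs n a t) x" if x: "x \<in> states n" "phi n a E x = x" for x
  proof (cases "gap_ratio n x = 0")
    case True
    then have "x = pure_state top_index" using phi_eq_gibbs_step[OF x(1)] x(2) by (simp add: gibbs_step_def)
    then show ?thesis using gibbs_le_pure[OF assms(2)] by simp
  next
    case False
    define r where "r = - ln (gap_ratio n x) / slope"
    define s where "s = I_f n a E r"
    have xs: "x = gibbs n a s" using phi_eq_gibbs_step[OF x(1)] x(2) False by (simp add: gibbs_step_def s_def r_def)
    have "0 \<le> r * slope"
      unfolding r_def using False gap_ratio_bounds[OF two_le x(1)]
      by (intro exponent_towards_top) auto
    then have "0 \<le> s * slope" unfolding s_def by (rule I_f_towards_top)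
    then have "gap_ratio n x = exp (- (s * slope))" unfolding xs by (rule gap_ratio_gibbs)
    then have "r = s" using slope_nonzero by (simp add: r_def)
    then have "mean_gap n a E s = 0" using ends_less by (simp add: s_def I_f_def)
    then have "gibbs n a t = x"
      using max_entropy_state_iff[OF one_le] assms(1) xs by metis
    then show ?thesis by (simp add: pairwise_le_refl)
  qed
  then show ?thesis using g fixed by (auto simp: least_def fps bayes_order_le[OF two_le])
qed

end

theorem theorem5p8:
  fixes n :: nat and a :: "nat \<Rightarrow> real" and E :: real
  assumes "n \<ge> 2"
    and "\<And>i. 1 \<le> i \<Longrightarrow> i < n \<Longrightarrow> a i < a (i + 1)"
    and "a 1 < E" and "E < a n"
  shows "scott_continuous (bayes_order n) (bayes_order n) (phi n a E) \<and>
         (\<exists>!y. max_entropy_state n a E y) \<and>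
         (\<forall>y. max_entropy_state n a E y \<longrightarrow>
              least (bayes_order n) y (fps (bayes_order n) (phi n a E)))"
proof -
  interpret mean_energy n a E by unfold_locales (use assms in auto)
  obtain t where t: "mean_gap n a E t = 0" "0 \<le> t * slope" by (rule mean_gap_root)
  show ?thesis
    using scott_continuous_phi least_fixed_point[OF t] max_entropy_state_iff[OF one_le t(1)] by auto
qed

end
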